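(* Let $(\Omega,\mathcal{F})$ be a standard Borel space and let $E\subset\Omega\times\Omega$ be a measurable equivalence relation. Then, for all $\mu,\nu\in\mathcal{P}(\mathcal{F})$, there is a set $B\in\mathcal{F}$ such that $$\mu(B)=\nu(B)=1\quad\text{and}\quad\inf_{P\in\Gamma(\mu,\nu)}(1-P(E))=\|\mu-\nu\|_{\mathcal{G}_B},$$ where $\mathcal{G}_B=\{A\in\mathcal{F}:\ 1_A(x)=1_A(y)\text{ for all }(x,y)\in E\cap(B\times B)\}$.
   Context: A measurable space $(\Omega,\mathcal{F})$ is a standard Borel space if $\mathcal{F}$ is the Borel $\sigma$-field of some Polish (separable, completely metrizable) topology on $\Omega$. $\mathcal{P}(\mathcal{F})$ is the set of all probability measures on $\mathcal{F}$. A measurable equivalence relation is a set $E\in\mathcal{F}\otimes\mathcal{F}$ such that the relation $x\sim y\Leftrightarrow(x,y)\in E$ is reflexive, symmetric and transitive on $\Omega$. $\Gamma(\mu,\nu)$ is the set of all ($\sigma$-additive) probability measures $P$ on $\mathcal{F}\otimes\mathcal{F}$ with marginals $\mu$ and $\nu$, i.e. $P(A\times\Omega)=\mu(A)$ and $P(\Omega\times A)=\nu(A)$ for all $A\in\mathcal{F}$. For a sub-$\sigma$-field $\mathcal{G}\subset\mathcal{F}$, $\|\mu-\nu\|_{\mathcal{G}}=\sup_{A\in\mathcal{G}}|\mu(A)-\nu(A)|$. *)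

theory Defs
  imports "HOL-Probability.Probability"
begin

text \<open>
  Here \<open>M\<close> carries only the measurable space \<open>(\<Omega>, \<F>) = (space M, sets M)\<close>; its measure
  component plays no role. The probability measures on \<open>\<F>\<close> are \<open>space (prob_algebra M)\<close>.
\<close>

definition standard_borel_space :: "'a measure \<Rightarrow> bool" where
  "standard_borel_space M \<longleftrightarrow>
     (\<exists>T. topspace T = space M \<and> separable_space T \<and> completely_metrizable_space T \<and>
          sets M = sigma_sets (space M) {U. openin T U})"

definition measurable_equivalence :: "'a measure \<Rightarrow> ('a \<times> 'a) set \<Rightarrow> bool" where
  "measurable_equivalence M E \<longleftrightarrow> E \<in> sets (M \<Otimes>\<^sub>M M) \<and> equiv (space M) E"

definition couplings :: "'a measure \<Rightarrow> 'a measure \<Rightarrow> 'a measure \<Rightarrow> ('a \<times> 'a) measure set" where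
  "couplings M \<mu> \<nu> =
     {P \<in> space (prob_algebra (M \<Otimes>\<^sub>M M)).
        \<forall>A\<in>sets M. measure P (A \<times> space M) = measure \<mu> A \<and> measure P (space M \<times> A) = measure \<nu> A}"

text \<open>
  For probability measures the supremum below ranges over a subset of \<open>{0..1}\<close>, so the supremum
  in the conditionally complete reals is the intended one as soon as \<open>\<G>\<close> is nonempty.
\<close>

definition variation_on :: "'a set set \<Rightarrow> 'a measure \<Rightarrow> 'a measure \<Rightarrow> real" where
  "variation_on \<G> \<mu> \<nu> = (SUP A\<in>\<G>. \<bar>measure \<mu> A - measure \<nu> A\<bar>)"

text \<open>
  Invariance is required on \<open>B\<close> only; the members are arbitrary sets in \<open>\<F>\<close>, not subsets of \<open>B\<close>.
\<close>

definition invariant_sets_on :: "'a measure \<Rightarrow> ('a \<times> 'a) set \<Rightarrow> 'a set \<Rightarrow> 'a set set" where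
  "invariant_sets_on M E B =
     {A \<in> sets M. \<forall>(x, y)\<in>E \<inter> (B \<times> B). (indicator A x :: real) = indicator A y}"

end

theory Submission
  imports Defs
begin

text \<open>
  Call a pair of Borel sets \<open>(X, Y)\<close> a cover of \<open>E\<close> if every \<open>(x, y) \<in> E\<close> has \<open>x \<in> X\<close> or \<open>y \<in> Y\<close>, and let
  \<open>cap E\<close> be the least value of \<open>\<mu>(X) + \<nu>(Y)\<close> over all covers. The main point is Kellerer's duality
  \<open>cap E = sup {P(E). P a coupling}\<close> for Borel \<open>E\<close>, in the sharper form that the supremum may be
  taken over \<open>P(K)\<close> with \<open>K \<subseteq> E\<close> compact. It follows from Choquet's capacitability argument, which
  reduces it to compact sets, and for those from Hall's marriage theorem with real weights, applied
  to finite partitions, by a compactness argument.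

  Now let \<open>(X, Y)\<close> be an optimal cover of an equivalence relation \<open>E\<close>, and let \<open>P\<^sub>n\<close> and \<open>K\<^sub>n\<close> be
  near-optimal. No point of \<open>- X\<close> is related to a point of \<open>- Y\<close>. By complementary slackness almost
  all of \<open>\<nu>\<close> on \<open>Y\<close> sits on points that some \<open>K\<^sub>n\<close> links to \<open>- X\<close>, and almost all of \<open>\<mu>\<close> on \<open>X\<close> on points
  that some \<open>K\<^sub>n\<close> links to \<open>- Y\<close>. The sets of linked points are \<open>\<sigma>\<close>-compact (after shrinking \<open>- X\<close> and
  \<open>- Y\<close> to \<open>\<sigma>\<close>-compact sets), so no measurability of saturations is needed. Adding them to \<open>- X\<close> and
  \<open>- Y\<close> gives Borel sets \<open>A\<close> and \<open>A'\<close> that are not related to each other, and \<open>B = A \<union> A'\<close> works.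
\<close>

section \<open>Finite couplings\<close>

text \<open>
  In the inductive step as much weight as possible is moved along one edge \<open>(i, j)\<close>. Then the row \<open>i\<close>
  or the column \<open>j\<close> is used up, or some Hall condition becomes tight and the problem splits in two.
\<close>

lemma weighted_hall:
  fixes a :: "'i \<Rightarrow> real" and b :: "'j \<Rightarrow> real"
  assumes "finite I" "finite J"
    and "\<And>i. i \<in> I \<Longrightarrow> 0 \<le> a i" "\<And>j. j \<in> J \<Longrightarrow> 0 \<le> b j"
    and "\<And>S. S \<subseteq> I \<Longrightarrow> sum a S \<le> sum b {j\<in>J. \<exists>i\<in>S. R i j}"
  shows "\<exists>q. (\<forall>i j. 0 \<le> q i j \<and> (q i j \<noteq> 0 \<longrightarrow> i \<in> I \<and> j \<in> J \<and> R i j)) \<and>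
             (\<forall>i\<in>I. (\<Sum>j\<in>J. q i j) = a i) \<and> (\<forall>j\<in>J. (\<Sum>i\<in>I. q i j) \<le> b j)"
  using assms
proof (induction "card I + card J" arbitrary: I J a b rule: less_induct)
  case less
  note fin = less.prems(1,2) and a0 = less.prems(3) and b0 = less.prems(4)
    and hall = less.prems(5)
  define N where "N S = {j\<in>J. \<exists>i\<in>S. R i j}" for S
  have finN: "finite (N S)" for S using fin by (auto simp: N_def)
  have hallN: "sum a S \<le> sum b (N S)" if "S \<subseteq> I" for S
    using hall[OF that] by (simp add: N_def)
  show ?case
  proof (cases "I = {}")
    case True
    then show ?thesis using b0 by (intro exI[of _ "\<lambda>_ _. 0"]) auto
  next
    case False
    then obtain i where i: "i \<in> I" by blast
    show ?thesis
    proof (cases "N {i} = {}")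
      case True
      with hallN[of "{i}"] i a0[OF i] have ai: "a i = 0" by simp
      have "card (I - {i}) < card I" using i fin by (intro card_Diff1_less)
      then have lt: "card (I - {i}) + card J < card I + card J" by simp
      have "\<exists>q. (\<forall>i' j. 0 \<le> q i' j \<and> (q i' j \<noteq> 0 \<longrightarrow> i' \<in> I - {i} \<and> j \<in> J \<and> R i' j)) \<and>
          (\<forall>i'\<in>I - {i}. (\<Sum>j\<in>J. q i' j) = a i') \<and> (\<forall>j\<in>J. (\<Sum>i'\<in>I-{i}. q i' j) \<le> b j)"
      proof (rule less.hyps[OF lt])
        fix S assume "S \<subseteq> I - {i}"
        then have "S \<subseteq> I" by auto
        from hall[OF this] show "sum a S \<le> sum b {j\<in>J. \<exists>i\<in>S. R i j}" .
      qed (use fin a0 b0 in auto)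
      then obtain q where q: "\<forall>i' j. 0 \<le> q i' j \<and> (q i' j \<noteq> 0 \<longrightarrow> i' \<in> I - {i} \<and> j \<in> J \<and> R i' j)"
        "\<forall>i'\<in>I - {i}. (\<Sum>j\<in>J. q i' j) = a i'" "\<forall>j\<in>J. (\<Sum>i'\<in>I-{i}. q i' j) \<le> b j"
        by blast
      have qi: "q i j = 0" for j using q(1) by auto
      have "(\<Sum>i'\<in>I. q i' j) = (\<Sum>i'\<in>I-{i}. q i' j)" for j
        using sum.remove[OF fin(1) i, of "\<lambda>i. q i j"] qi by simp
      then show ?thesis using q qi ai by (intro exI[of _ q]) auto
    next
      case False
      then obtain j where j: "j \<in> J" "R i j" by (auto simp: N_def)
      \<comment> \<open>Lowering \<open>a i\<close> and \<open>b j\<close> by \<open>t\<close> hurts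
        a Hall condition only if \<open>i \<notin> S\<close> and \<open>j \<in> N S\<close>: for
        \<open>i \<in> S\<close> also \<open>j \<in> N S\<close>, and both sides drop by
        \<open>t\<close>. So \<open>T\<close> collects all constraints on \<open>t\<close> besides
        \<open>a i\<close> and \<open>b j\<close>.\<close>
      define T where "T = {S. S \<subseteq> I - {i} \<and> j \<in> N S}"
      define V where "V = insert (a i) (insert (b j) ((\<lambda>S. sum b (N S) - sum a S) ` T))"
      define t where "t = Min V"
      have "finite T" unfolding T_def using fin by (auto intro: finite_subset[OF _ finite_Pow_iff[THEN iffD2, OF fin(1)]])
      then have finV: "finite V" by (simp add: V_def)
      have tV: "t \<in> V" unfolding t_def using finV by (intro Min_in) (auto simp: V_def)
      have t_le: "t \<le> v" if "v \<in> V" for v unfolding t_def using finV that by simp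
      have t0: "0 \<le> t"
      proof -
        have "0 \<le> sum b (N S) - sum a S" if "S \<in> T" for S
          using hallN[of S] that by (auto simp: T_def)
        then show ?thesis using tV a0[OF i] b0[OF j(1)] unfolding V_def by blast
      qed
      define a' where "a' = a(i := a i - t)"
      define b' where "b' = b(j := b j - t)"
      have a': "0 \<le> a' k" if "k \<in> I" for k
        using that a0 t_le[of "a i"] by (auto simp: a'_def V_def)
      have b': "0 \<le> b' k" if "k \<in> J" for k
        using that b0 t_le[of "b j"] by (auto simp: b'_def V_def)
      have suma: "sum a' S = sum a S - (if i \<in> S then t else 0)" if "finite S" for S
      proof (cases "i \<in> S")
        case True
        then show ?thesis using that sum.remove[OF that True, of a'] sum.remove[OF that True, of a]
          by (simp add: a'_def)
      next
        case False
        then have "sum a' S = sum a S" by (intro sum.cong) (auto simp: a'_def)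
        then show ?thesis using False by simp
      qed
      have sumb: "sum b' S = sum b S - (if j \<in> S then t else 0)" if "finite S" for S
      proof (cases "j \<in> S")
        case True
        then show ?thesis using that sum.remove[OF that True, of b'] sum.remove[OF that True, of b]
          by (simp add: b'_def)
      next
        case False
        then have "sum b' S = sum b S" by (intro sum.cong) (auto simp: b'_def)
        then show ?thesis using False by simp
      qed
      have hall': "sum a' S \<le> sum b' (N S)" if S: "S \<subseteq> I" for S
      proof -
        have fS: "finite S" using S fin finite_subset by blast
        show ?thesis
        proof (cases "i \<in> S")
          case True
          then have "j \<in> N S" using j by (auto simp: N_def)
          then show ?thesis using True suma[OF fS] sumb[OF finN] hallN[OF S] by simp
        next
          case False
          show ?thesis
          proof (cases "j \<in> N S")
            case True
            with False S have "S \<in> T" by (auto simp: T_def)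
            then have "t \<le> sum b (N S) - sum a S" by (intro t_le) (auto simp: V_def)
            then show ?thesis using False True suma[OF fS] sumb[OF finN] by simp
          qed (use False suma[OF fS] sumb[OF finN] hallN[OF S] in simp)
        qed
      qed
      have key: ?thesis if ex: "\<exists>q. (\<forall>i j. 0 \<le> q i j \<and> (q i j \<noteq> 0 \<longrightarrow> i \<in> I \<and> j \<in> J \<and> R i j)) \<and>
             (\<forall>i\<in>I. (\<Sum>j\<in>J. q i j) = a' i) \<and> (\<forall>j\<in>J. (\<Sum>i\<in>I. q i j) \<le> b' j)"
      proof -
        from ex obtain q where q: "\<forall>i j. 0 \<le> q i j \<and> (q i j \<noteq> 0 \<longrightarrow> i \<in> I \<and> j \<in> J \<and> R i j)"
             "\<forall>i\<in>I. (\<Sum>j\<in>J. q i j) = a' i" "\<forall>j\<in>J. (\<Sum>i\<in>I. q i j) \<le> b' j" by blast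
        define p where "p i' j' = q i' j' + (if i' = i \<and> j' = j then t else 0)" for i' j'
        have "(\<Sum>j'\<in>J. p i' j') = a i'" if "i' \<in> I" for i'
          using that fin j q(2) by (auto simp: p_def sum.distrib a'_def)
        moreover have "(\<Sum>i'\<in>I. p i' j') \<le> b j'" if "j' \<in> J" for j'
          using that fin i q(3) by (cases "j' = j") (auto simp: p_def sum.distrib b'_def)
        moreover have "0 \<le> p i' j' \<and> (p i' j' \<noteq> 0 \<longrightarrow> i' \<in> I \<and> j' \<in> J \<and> R i' j')" for i' j'
          using q(1) t0 i j by (auto simp: p_def)
        ultimately show ?thesis by blast
      qed
      consider "t = a i" | "t = b j" | S where "S \<in> T" "t = sum b (N S) - sum a S"
        using tV by (auto simp: V_def)
      then show ?thesis
      proof cases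
        case 1
        have "card (I - {i}) < card I" using i fin by (intro card_Diff1_less)
        then have lt: "card (I - {i}) + card J < card I + card J" by simp
        have "\<exists>q. (\<forall>i' j. 0 \<le> q i' j \<and> (q i' j \<noteq> 0 \<longrightarrow> i' \<in> I - {i} \<and> j \<in> J \<and> R i' j)) \<and>
          (\<forall>i'\<in>I - {i}. (\<Sum>j\<in>J. q i' j) = a' i') \<and> (\<forall>j\<in>J. (\<Sum>i'\<in>I-{i}. q i' j) \<le> b' j)"
        proof (rule less.hyps[OF lt])
          fix S assume "S \<subseteq> I - {i}"
          then have "S \<subseteq> I" by auto
          from hall'[OF this] show "sum a' S \<le> sum b' {j\<in>J. \<exists>i\<in>S. R i j}" by (simp add: N_def)
        qed (use fin a' b' in auto)
        then obtain q where q: "\<forall>i' j. 0 \<le> q i' j \<and> (q i' j \<noteq> 0 \<longrightarrow> i' \<in> I - {i} \<and> j \<in> J \<and> R i' j)"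
          "\<forall>i'\<in>I - {i}. (\<Sum>j\<in>J. q i' j) = a' i'" "\<forall>j\<in>J. (\<Sum>i'\<in>I-{i}. q i' j) \<le> b' j"
          by blast
        have qi: "q i j = 0" for j using q(1) by auto
        have "(\<Sum>i'\<in>I. q i' j) = (\<Sum>i'\<in>I-{i}. q i' j)" for j
          using sum.remove[OF fin(1) i, of "\<lambda>i. q i j"] qi by simp
        then show ?thesis using q qi 1 by (intro key exI[of _ q]) (auto simp: a'_def)
      next
        case 2
        have "card (J - {j}) < card J" using j fin by (intro card_Diff1_less)
        then have lt: "card I + card (J - {j}) < card I + card J" by simp
        \<comment> \<open>Column \<open>j\<close> is exhausted, and removing a column of weight zero
          changes no sum over neighbours.\<close>
        have bj: "b' j = 0" using 2 by (simp add: b'_def)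
        have *: "sum b' {j'\<in>J-{j}. \<exists>i\<in>S. R i j'} = sum b' (N S)" for S
          using bj fin by (intro sum.mono_neutral_left) (auto simp: N_def)
        have "\<exists>q. (\<forall>i j'. 0 \<le> q i j' \<and> (q i j' \<noteq> 0 \<longrightarrow> i \<in> I \<and> j' \<in> J-{j} \<and> R i j')) \<and>
          (\<forall>i\<in>I. (\<Sum>j\<in>J-{j}. q i j) = a' i) \<and> (\<forall>j\<in>J-{j}. (\<Sum>i\<in>I. q i j) \<le> b' j)"
        proof (rule less.hyps[OF lt])
          fix S assume "S \<subseteq> I"
          from hall'[OF this] show "sum a' S \<le> sum b' {j'\<in>J-{j}. \<exists>i\<in>S. R i j'}" by (simp only: *)
        qed (use fin a' b' in auto)
        then obtain q where q: "\<forall>i j'. 0 \<le> q i j' \<and> (q i j' \<noteq> 0 \<longrightarrow> i \<in> I \<and> j' \<in> J-{j} \<and> R i j')"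
          "\<forall>i\<in>I. (\<Sum>j\<in>J-{j}. q i j) = a' i" "\<forall>j\<in>J-{j}. (\<Sum>i\<in>I. q i j) \<le> b' j"
          by blast
        have qi: "q i j = 0" for i using q(1) by auto
        have "(\<Sum>j\<in>J. q i' j) = (\<Sum>j\<in>J-{j}. q i' j)" for i'
          using sum.remove[OF fin(2) j(1), of "q i'"] qi by simp
        then show ?thesis using q qi bj by (intro key exI[of _ q]) auto
      next
        case 3
        then have S: "S \<subseteq> I - {i}" "j \<in> N S" by (auto simp: T_def)
        then have "S \<subset> I" using i by auto
        have fS: "finite S" using S fin finite_subset[of S I] by auto
        have tight: "sum a' S = sum b' (N S)"
          using 3 S suma[OF fS] sumb[OF finN[of S]] by auto
        have NJ: "N S \<subseteq> J" by (auto simp: N_def)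
        have "S \<noteq> {}" using S by (auto simp: N_def)
        have cS: "card S < card I" using \<open>S \<subset> I\<close> fin by (simp add: psubset_card_mono)
        have cN: "card (N S) \<le> card J" using NJ fin by (simp add: card_mono)
        have cS': "card (I - S) < card I"
          using \<open>S \<subset> I\<close> \<open>S \<noteq> {}\<close> fin by (intro psubset_card_mono) auto
        have cN': "card (J - N S) \<le> card J" using fin by (simp add: card_mono)
        have "\<exists>q. (\<forall>i j. 0 \<le> q i j \<and> (q i j \<noteq> 0 \<longrightarrow> i \<in> S \<and> j \<in> N S \<and> R i j)) \<and>
          (\<forall>i\<in>S. (\<Sum>j\<in>N S. q i j) = a' i) \<and> (\<forall>j\<in>N S. (\<Sum>i\<in>S. q i j) \<le> b' j)"
        proof (rule less.hyps)
          show "card S + card (N S) < card I + card J" using cS cN by simp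
          fix S' assume S': "S' \<subseteq> S"
          then have "{j\<in>N S. \<exists>i\<in>S'. R i j} = N S'" by (auto simp: N_def)
          then show "sum a' S' \<le> sum b' {j\<in>N S. \<exists>i\<in>S'. R i j}"
            using hall'[of S'] S' S by auto
        qed (use fS finN a' b' S NJ in auto)
        then obtain q1 where q1: "\<forall>i j. 0 \<le> q1 i j \<and> (q1 i j \<noteq> 0 \<longrightarrow> i \<in> S \<and> j \<in> N S \<and> R i j)"
          "\<forall>i\<in>S. (\<Sum>j\<in>N S. q1 i j) = a' i" "\<forall>j\<in>N S. (\<Sum>i\<in>S. q1 i j) \<le> b' j" by blast
        \<comment> \<open>The rows in \<open>S\<close> fill the columns in \<open>N S\<close>
          completely. Subtracting the equality \<open>tight\<close> from the Hall condition for
          \<open>S \<union> S'\<close> leaves the Hall condition for \<open>S'\<close> with these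
          columns removed.\<close>
        have "\<exists>q. (\<forall>i j. 0 \<le> q i j \<and> (q i j \<noteq> 0 \<longrightarrow> i \<in> I - S \<and> j \<in> J - N S \<and> R i j)) \<and>
          (\<forall>i\<in>I-S. (\<Sum>j\<in>J - N S. q i j) = a' i) \<and> (\<forall>j\<in>J - N S. (\<Sum>i\<in>I-S. q i j) \<le> b' j)"
        proof (rule less.hyps)
          show "card (I-S) + card (J - N S) < card I + card J" using cS' cN' by simp
          fix S' assume S': "S' \<subseteq> I - S"
          have fS': "finite S'" using S' fin finite_subset[of S' I] by auto
          have "sum a' S + sum a' S' = sum a' (S \<union> S')"
            using fS fS' S' by (subst sum.union_disjoint) auto
          also have "\<dots> \<le> sum b' (N (S \<union> S'))" using S S' by (intro hall') auto
          also have "N (S \<union> S') = N S \<union> {j\<in>J - N S. \<exists>i\<in>S'. R i j}" by (auto simp: N_def)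
          also have "sum b' \<dots> = sum b' (N S) + sum b' {j\<in>J - N S. \<exists>i\<in>S'. R i j}"
            using finN fin by (subst sum.union_disjoint) auto
          finally show "sum a' S' \<le> sum b' {j\<in>J - N S. \<exists>i\<in>S'. R i j}" using tight by simp
        qed (use fin a' b' in auto)
        then obtain q2 where q2: "\<forall>i j. 0 \<le> q2 i j \<and> (q2 i j \<noteq> 0 \<longrightarrow> i \<in> I - S \<and> j \<in> J - N S \<and> R i j)"
          "\<forall>i\<in>I-S. (\<Sum>j\<in>J - N S. q2 i j) = a' i" "\<forall>j\<in>J - N S. (\<Sum>i\<in>I-S. q2 i j) \<le> b' j" by blast
        define q where "q i j = q1 i j + q2 i j" for i j
        have J: "(\<Sum>j\<in>J. f j) = (\<Sum>j\<in>N S. f j) + (\<Sum>j\<in>J - N S. f j)" for f :: "'j \<Rightarrow> real"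
          using fin NJ by (subst sum.subset_diff[of "N S"]) auto
        have I: "(\<Sum>i\<in>I. f i) = (\<Sum>i\<in>S. f i) + (\<Sum>i\<in>I - S. f i)" for f :: "'i \<Rightarrow> real"
          using fin \<open>S \<subset> I\<close> by (subst sum.subset_diff[of S]) auto
        have q1z: "q1 i j = 0" if "i \<notin> S \<or> j \<notin> N S" for i j using q1(1) that by blast
        have q2z: "q2 i j = 0" if "i \<in> S \<or> j \<in> N S" for i j using q2(1) that by blast
        have "0 \<le> q i' j' \<and> (q i' j' \<noteq> 0 \<longrightarrow> i' \<in> I \<and> j' \<in> J \<and> R i' j')" for i' j'
        proof (cases "q1 i' j' = 0")
          case True
          then show ?thesis using q2(1) by (auto simp: q_def)
        next
          case False
          then have "i' \<in> S" "j' \<in> N S" "R i' j'" using q1(1) by blast+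
          then show ?thesis using q1(1) q2z[of i' j'] NJ S by (auto simp: q_def)
        qed
        moreover have "(\<Sum>j\<in>J. q i' j) = a' i'" if "i' \<in> I" for i'
          using q1(2) q2(2) that by (cases "i' \<in> S") (auto simp: J q_def q1z q2z)
        moreover have "(\<Sum>i\<in>I. q i j') \<le> b' j'" if "j' \<in> J" for j'
          using q1(3) q2(3) that by (cases "j' \<in> N S") (auto simp: I q_def q1z q2z)
        ultimately show ?thesis by (intro key exI[of _ q]) blast
      qed
    qed
  qed
qed

lemma finite_coupling:
  fixes a :: "'i \<Rightarrow> real" and b :: "'j \<Rightarrow> real"
  assumes fin: "finite I" "finite J"
    and a0: "\<And>i. i \<in> I \<Longrightarrow> 0 \<le> a i" and b0: "\<And>j. j \<in> J \<Longrightarrow> 0 \<le> b j"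
    and sums: "sum a I = sum b J" and d0: "0 \<le> d"
    and hall: "\<And>S. S \<subseteq> I \<Longrightarrow> sum a S \<le> sum b {j\<in>J. \<exists>i\<in>S. R i j} + d"
  shows "\<exists>q. (\<forall>i j. 0 \<le> q i j) \<and> (\<forall>i\<in>I. (\<Sum>j\<in>J. q i j) = a i) \<and>
     (\<forall>j\<in>J. (\<Sum>i\<in>I. q i j) = b j) \<and> sum a I - d \<le> (\<Sum>i\<in>I. \<Sum>j\<in>{j\<in>J. R i j}. q i j)"
proof -
  \<comment> \<open>An additional column of weight \<open>d\<close> absorbs the deficiency; what it receives is redistributed as a
    product.\<close>
  define J' where "J' = insert None (Some ` J)"
  define b' where "b' x = (case x of None \<Rightarrow> d | Some j \<Rightarrow> b j)" for x
  define R' where "R' i x = (case x of None \<Rightarrow> True | Some j \<Rightarrow> R i j)" for i x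
  have sumJ': "sum f J' = f None + (\<Sum>j\<in>J. f (Some j))" for f :: "'j option \<Rightarrow> real"
    using fin by (simp add: J'_def sum.reindex)
  have ex: "\<exists>q. (\<forall>i j. 0 \<le> q i j \<and> (q i j \<noteq> 0 \<longrightarrow> i \<in> I \<and> j \<in> J' \<and> R' i j)) \<and>
             (\<forall>i\<in>I. (\<Sum>j\<in>J'. q i j) = a i) \<and> (\<forall>j\<in>J'. (\<Sum>i\<in>I. q i j) \<le> b' j)"
  proof (rule weighted_hall)
    fix S assume S: "S \<subseteq> I"
    show "sum a S \<le> sum b' {j\<in>J'. \<exists>i\<in>S. R' i j}"
    proof (cases "S = {}")
      case False
      have "x \<in> {j\<in>J'. \<exists>i\<in>S. R' i j} \<longleftrightarrow> x \<in> insert None (Some ` {j\<in>J. \<exists>i\<in>S. R i j})" for x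
        using False by (cases x) (auto simp: J'_def R'_def image_iff)
      then have "{j\<in>J'. \<exists>i\<in>S. R' i j} = insert None (Some ` {j\<in>J. \<exists>i\<in>S. R i j})" by blast
      then show ?thesis using hall[OF S] fin by (simp add: sum.reindex b'_def)
    qed simp
  qed (use fin a0 b0 d0 in \<open>auto simp: J'_def b'_def\<close>)
  then obtain q where q': "\<forall>i j. 0 \<le> q i j \<and> (q i j \<noteq> 0 \<longrightarrow> i \<in> I \<and> j \<in> J' \<and> R' i j)"
    "\<forall>i\<in>I. (\<Sum>j\<in>J'. q i j) = a i" "\<forall>j\<in>J'. (\<Sum>i\<in>I. q i j) \<le> b' j" by blast
  have q: "\<And>i j. 0 \<le> q i j" "\<And>i j. q i j \<noteq> 0 \<Longrightarrow> R' i j"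
     "\<And>i. i \<in> I \<Longrightarrow> q i None + (\<Sum>j\<in>J. q i (Some j)) = a i"
     "\<And>j. j \<in> J \<Longrightarrow> (\<Sum>i\<in>I. q i (Some j)) \<le> b j" "(\<Sum>i\<in>I. q i None) \<le> d"
    subgoal using q'(1) by blast
    subgoal using q'(1) by blast
    subgoal for i using q'(2) by (simp add: sumJ')
    subgoal for j using bspec[OF q'(3), of "Some j"] by (simp add: J'_def b'_def)
    subgoal using bspec[OF q'(3), of None] by (simp add: J'_def b'_def)
    done
  define r where "r = (\<Sum>i\<in>I. q i None)"
  define s where "s j = b j - (\<Sum>i\<in>I. q i (Some j))" for j
  have "sum a I = (\<Sum>i\<in>I. q i None + (\<Sum>j\<in>J. q i (Some j)))" using q(3) by simp
  also have "\<dots> = r + (\<Sum>i\<in>I. \<Sum>j\<in>J. q i (Some j))" by (simp add: sum.distrib r_def)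
  finally have tot: "sum a I = r + (\<Sum>i\<in>I. \<Sum>j\<in>J. q i (Some j))" .
  have sr: "sum s J = r"
    using tot sums by (simp add: s_def sum_subtractf sum.swap[of _ J I])
  have r0: "0 \<le> r" using q(1) by (simp add: r_def sum_nonneg)
  have s0: "0 \<le> s j" if "j \<in> J" for j using q(4)[OF that] by (simp add: s_def)
  \<comment> \<open>These two facts cover the division by \<open>r = 0\<close> in \<open>p\<close>:
    all \<open>q i None\<close> and \<open>s j\<close> then vanish, so the default value 0 of the
    quotient is the correct one.\<close>
  have rz: "q i None = 0" if "r = 0" "i \<in> I" for i
    using that fin q(1) by (simp add: r_def sum_nonneg_eq_0_iff)
  have sz: "s j = 0" if "r = 0" "j \<in> J" for j
    using that fin s0 sr by (simp add: sum_nonneg_eq_0_iff)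
  define p where "p i j = (if j \<in> J then q i (Some j) + q i None * s j / r else 0)" for i j
  have "0 \<le> p i j" for i j using q(1) s0 r0 by (simp add: p_def)
  moreover have "(\<Sum>j\<in>J. p i j) = a i" if i: "i \<in> I" for i
  proof -
    have "(\<Sum>j\<in>J. p i j) = (\<Sum>j\<in>J. q i (Some j)) + (\<Sum>j\<in>J. q i None * s j / r)"
      by (simp add: p_def sum.distrib)
    also have "(\<Sum>j\<in>J. q i None * s j / r) = q i None * sum s J / r"
      by (simp add: sum_distrib_left sum_divide_distrib)
    also have "\<dots> = q i None" using rz[OF _ i] by (cases "r = 0") (auto simp: sr)
    finally show ?thesis using q(3)[OF i] by simp
  qed
  moreover have "(\<Sum>i\<in>I. p i j) = b j" if j: "j \<in> J" for j
  proof -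
    have "(\<Sum>i\<in>I. p i j) = (\<Sum>i\<in>I. q i (Some j)) + (\<Sum>i\<in>I. q i None * s j / r)"
      using j by (simp add: p_def sum.distrib)
    also have "(\<Sum>i\<in>I. q i None * s j / r) = r * s j / r"
      by (simp add: sum_distrib_right sum_divide_distrib r_def)
    also have "\<dots> = s j" using sz[OF _ j] by (cases "r = 0") auto
    finally show ?thesis by (simp add: s_def)
  qed
  moreover have "sum a I - d \<le> (\<Sum>i\<in>I. \<Sum>j\<in>{j\<in>J. R i j}. p i j)"
  proof -
    have "sum a I - d \<le> (\<Sum>i\<in>I. \<Sum>j\<in>J. q i (Some j))" using tot q(5) by (simp add: r_def)
    also have "\<dots> = (\<Sum>i\<in>I. \<Sum>j\<in>{j\<in>J. R i j}. q i (Some j))"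
    proof (rule sum.cong[OF refl], rule sum.mono_neutral_right)
      show "\<forall>j\<in>J - {j\<in>J. R i j}. q i (Some j) = 0" for i
        using q(2)[of i "Some _"] by (auto simp: R'_def)
    qed (use fin in auto)
    also have "\<dots> \<le> (\<Sum>i\<in>I. \<Sum>j\<in>{j\<in>J. R i j}. p i j)"
      using q(1) s0 r0 by (intro sum_mono) (auto simp: p_def)
    finally show ?thesis .
  qed
  ultimately show ?thesis by blast
qed

section \<open>The covering capacity\<close>

lemma borel_Times:
  fixes A :: "'a::second_countable_topology set" and B :: "'b::second_countable_topology set"
  assumes "A \<in> sets borel" "B \<in> sets borel"
  shows "A \<times> B \<in> sets borel"
  by (subst borel_prod[symmetric]) (rule pair_measureI[OF assms])

lemma open_outer:
  assumes M: "prob_space M" "sets M = sets borel" and A: "A \<in> sets borel" and "0 < e"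
  shows "\<exists>U::'c::polish_space set. open U \<and> A \<subseteq> U \<and> measure M U < measure M A + e"
proof -
  interpret prob_space M by fact
  have "(INF U \<in> {U. A \<subseteq> U \<and> open U}. emeasure M U) = emeasure M A"
    by (rule outer_regular[symmetric]) (use M A in auto)
  also have "\<dots> < ennreal (measure M A + e)"
    using \<open>0 < e\<close> by (simp add: emeasure_eq_measure ennreal_less_iff)
  finally obtain U where "A \<subseteq> U" "open U" "emeasure M U < ennreal (measure M A + e)"
    by (auto simp: INF_less_iff)
  then have "measure M U < measure M A + e"
    unfolding emeasure_eq_measure by (subst (asm) ennreal_less_iff) auto
  then show ?thesis using \<open>A \<subseteq> U\<close> \<open>open U\<close> by blast
qed

lemma compact_inner:
  assumes M: "prob_space M" "sets M = sets borel" and A: "A \<in> sets borel" and "0 < e"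
  shows "\<exists>K::'c::polish_space set. compact K \<and> K \<subseteq> A \<and> measure M A - e < measure M K"
proof -
  interpret prob_space M by fact
  show ?thesis
  proof (cases "measure M A - e < 0")
    case True
    then show ?thesis by (intro exI[of _ "{}"]) auto
  next
    case False
    have "ennreal (measure M A - e) < emeasure M A"
      using \<open>0 < e\<close> False by (simp add: emeasure_eq_measure ennreal_less_iff)
    also have "\<dots> = (SUP K \<in> {K. K \<subseteq> A \<and> compact K}. emeasure M K)"
      by (rule inner_regular) (use M A in auto)
    finally obtain K where "K \<subseteq> A" "compact K" "ennreal (measure M A - e) < emeasure M K"
      by (auto simp: less_SUP_iff)
    then show ?thesis using False by (auto simp: emeasure_eq_measure ennreal_less_iff)
  qed
qed

locale marginals = \<mu>: prob_space \<mu> + \<nu>: prob_space \<nu>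
  for \<mu> :: "'a::polish_space measure" and \<nu> :: "'b::polish_space measure" +
  assumes sets_\<mu> [measurable_cong, simp]: "sets \<mu> = sets borel"
    and sets_\<nu> [measurable_cong, simp]: "sets \<nu> = sets borel"
begin

lemma space_\<mu> [simp]: "space \<mu> = UNIV" and space_\<nu> [simp]: "space \<nu> = UNIV"
  using sets_eq_imp_space_eq[OF sets_\<mu>] sets_eq_imp_space_eq[OF sets_\<nu>] by simp_all

definition covers :: "'a set \<Rightarrow> 'b set \<Rightarrow> ('a \<times> 'b) set \<Rightarrow> bool" where
  "covers X Y A \<longleftrightarrow> X \<in> sets borel \<and> Y \<in> sets borel \<and> A \<subseteq> X \<times> UNIV \<union> UNIV \<times> Y"

text \<open>The value of the linear program dual to maximising the mass of \<open>A\<close> over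
  couplings. It is defined for arbitrary sets because the capacitability argument applies it to
  projections of closed sets.\<close>

definition cap :: "('a \<times> 'b) set \<Rightarrow> real" where
  "cap A = (INF (X, Y)\<in>{(X, Y). covers X Y A}. measure \<mu> X + measure \<nu> Y)"

lemma cap_le: "covers X Y A \<Longrightarrow> cap A \<le> measure \<mu> X + measure \<nu> Y"
  unfolding cap_def by (rule cINF_lower2[of _ _ "(X, Y)"]) (auto intro!: bdd_belowI2[of _ 0])

lemma cap_lessE:
  assumes "cap A < c"
  obtains X Y where "covers X Y A" "measure \<mu> X + measure \<nu> Y < c"
proof -
  have "(UNIV, UNIV) \<in> {(X, Y). covers X Y A}" by (auto simp: covers_def)
  moreover have "bdd_below ((\<lambda>(X, Y). measure \<mu> X + measure \<nu> Y) ` {(X, Y). covers X Y A})"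
    by (auto intro!: bdd_belowI2[of _ 0])
  ultimately show ?thesis using assms that unfolding cap_def
    by (subst (asm) cINF_less_iff) auto
qed

lemma cap_mono: "A \<subseteq> A' \<Longrightarrow> cap A \<le> cap A'"
  by (rule field_le_epsilon, rule ccontr)
     (smt (verit, ccfv_SIG) cap_lessE cap_le covers_def subset_trans)

lemma cap_le_1: "cap A \<le> 1"
  using cap_le[of UNIV "{}" A] \<mu>.prob_space by (auto simp: covers_def)

text \<open>Adding \<open>- D\<close> and \<open>- D'\<close> to a cover of the restricted set
  covers all of \<open>A\<close>. This confines a set to a compact rectangle at small cost.\<close>

lemma cap_add_cover:
  assumes "D \<in> sets borel" "D' \<in> sets borel"
  shows "cap A \<le> cap (A \<inter> D \<times> D') + measure \<mu> (- D) + measure \<nu> (- D')"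
proof (rule field_le_epsilon)
  fix e :: real assume "0 < e"
  then obtain X Y where XY: "covers X Y (A \<inter> D \<times> D')"
    "measure \<mu> X + measure \<nu> Y < cap (A \<inter> D \<times> D') + e"
    using cap_lessE[of "A \<inter> D \<times> D'" "cap (A \<inter> D \<times> D') + e"] by auto
  then have "covers (X \<union> - D) (Y \<union> - D') A" using assms by (auto simp: covers_def)
  then have "cap A \<le> measure \<mu> (X \<union> - D) + measure \<nu> (Y \<union> - D')" by (rule cap_le)
  also have "\<dots> \<le> (measure \<mu> X + measure \<mu> (- D)) + (measure \<nu> Y + measure \<nu> (- D'))"
    using XY(1) assms by (intro add_mono measure_Un_le)
      (auto simp: covers_def)
  finally show "cap A \<le> cap (A \<inter> D \<times> D') + measure \<mu> (- D) + measure \<nu> (- D') + e"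
    using XY(2) by simp
qed

lemma covers_join:
  assumes "covers X Y A" "covers X' Y' A"
  shows "covers (X \<union> X') (Y \<inter> Y') A" "covers (X \<inter> X') (Y \<union> Y') A"
  using assms by (auto simp: covers_def)

text \<open>Each marginal is modular by itself. Unions on one side are paired with intersections on
  the other because these combinations of two covers of a set are covers again, by
  \<open>covers_join\<close>.\<close>

lemma cover_modular:
  assumes "covers X Y A" "covers X' Y' A'"
  shows "(measure \<mu> (X \<union> X') + measure \<nu> (Y \<inter> Y')) + (measure \<mu> (X \<inter> X') + measure \<nu> (Y \<union> Y'))
    = (measure \<mu> X + measure \<nu> Y) + (measure \<mu> X' + measure \<nu> Y')"
  using assms \<mu>.finite_measure_Union' [of X X'] \<mu>.finite_measure_Diff' [of X' X]
    \<nu>.finite_measure_Union' [of Y Y'] \<nu>.finite_measure_Diff' [of Y' Y]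
  by (auto simp: covers_def Int_commute)

text \<open>
  If \<open>(X\<^sub>n, Y\<^sub>n)\<close> are near-optimal covers of \<open>A\<^sub>n\<close>, then \<open>(limsup X\<^sub>n, liminf Y\<^sub>n)\<close> covers the union, and
  modularity of the cost keeps it near-optimal, since \<open>(X \<inter> X', Y \<union> Y')\<close> is again a cover.
\<close>

lemma cover_Union:
  assumes A: "incseq A" and c: "\<And>n. cap (A n) \<le> c"
  obtains X Y where "covers X Y (\<Union>n. A n)" "measure \<mu> X + measure \<nu> Y \<le> c"
proof -
  have "\<exists>X Y. covers X Y (A n) \<and> measure \<mu> X + measure \<nu> Y < cap (A n) + (1/2)^n" for n
    by (rule cap_lessE[of "A n" "cap (A n) + (1/2)^n"]) auto
  then obtain X Y where XY: "\<And>n. covers (X n) (Y n) (A n)"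
    "\<And>n. measure \<mu> (X n) + measure \<nu> (Y n) < cap (A n) + (1/2)^n" by metis
  have [measurable]: "X n \<in> sets borel" "Y n \<in> sets borel" for n
    using XY(1) by (auto simp: covers_def)
  define U where "U n k = (\<Union>i\<in>{n..n+k}. X i)" for n k
  define V where "V n k = (\<Inter>i\<in>{n..n+k}. Y i)" for n k
  have U_Suc: "U n (Suc k) = X n \<union> U (Suc n) k" and V_Suc: "V n (Suc k) = Y n \<inter> V (Suc n) k" for n k
    using atLeastAtMost_insertL[of n "n + Suc k"] by (auto simp: U_def V_def simp flip: atLeastAtMost_insertL)
  have cov: "covers (U n k) (V n k) (A n)" for n k
  proof -
    have "A n \<subseteq> X i \<times> UNIV \<union> UNIV \<times> Y i" if "n \<le> i" for i
      using XY(1)[of i] incseqD[OF A that] by (auto simp: covers_def)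
    then show ?thesis by (fastforce simp: covers_def U_def V_def)
  qed
  \<comment> \<open>Uncrossing \<open>(X n, Y n)\<close> with the block starting at
    \<open>Suc n\<close> gives two covers of \<open>A n\<close>. The discarded one costs at least
    \<open>cap (A n)\<close>, so the other exceeds the cost of the block by less than
    \<open>(1/2)^n\<close>, and these errors stay below \<open>2 * (1/2)^n\<close> in total.\<close>
  have val: "measure \<mu> (U n k) + measure \<nu> (V n k) \<le> c + 2 * (1/2)^n" for n k
  proof (induction k arbitrary: n)
    case 0
    have "U n 0 = X n" "V n 0 = Y n" "0 < (1/2::real)^n" by (simp_all add: U_def V_def)
    moreover have "p \<le> c + 2 * z" if "p < c' + z" "c' \<le> c" "0 < z" for p c' z :: real
      using that by linarith
    ultimately show ?case using XY(2)[of n] c[of n] by metis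
  next
    case (Suc k)
    have cov': "covers (U (Suc n) k) (V (Suc n) k) (A n)"
      using cov[of "Suc n" k] incseqD[OF A, of n "Suc n"] by (auto simp: covers_def)
    have "cap (A n) \<le> measure \<mu> (X n \<inter> U (Suc n) k) + measure \<nu> (Y n \<union> V (Suc n) k)"
      by (intro cap_le covers_join(2) XY cov')
    with cover_modular[OF XY(1)[of n] cov'] XY(2)[of n] Suc.IH[of "Suc n"]
    show ?case by (simp add: U_Suc V_Suc)
  qed
  define X' where "X' n = (\<Union>i\<in>{n..}. X i)" for n
  define Y' where "Y' n = (\<Inter>i\<in>{n..}. Y i)" for n
  have [measurable]: "X' n \<in> sets borel" "Y' n \<in> sets borel" for n by (auto simp: X'_def Y'_def)
  have [measurable]: "U n k \<in> sets borel" "V n k \<in> sets borel" for n k by (auto simp: U_def V_def)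
  have val': "measure \<mu> (X' n) + measure \<nu> (Y' n) \<le> c + 2 * (1/2)^n" for n
  proof (rule LIMSEQ_le_const2)
    have "(\<lambda>k. measure \<mu> (U n k)) \<longlonglongrightarrow> measure \<mu> (\<Union>k. U n k)"
      by (intro \<mu>.finite_Lim_measure_incseq) (auto simp: incseq_def U_def, force)
    moreover have "(\<Union>k. U n k) = X' n"
    proof -
      have "X' n \<subseteq> (\<Union>k. U n k)"
      proof
        fix x assume "x \<in> X' n"
        then obtain i where "n \<le> i" "x \<in> X i" unfolding X'_def by blast
        then have "x \<in> U n (i - n)" unfolding U_def by auto
        then show "x \<in> (\<Union>k. U n k)" by (rule UN_I[OF UNIV_I])
      qed
      moreover have "(\<Union>k. U n k) \<subseteq> X' n" by (auto simp: U_def X'_def)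
      ultimately show ?thesis by blast
    qed
    moreover have "(\<lambda>k. measure \<nu> (V n k)) \<longlonglongrightarrow> measure \<nu> (\<Inter>k. V n k)"
      by (intro \<nu>.finite_Lim_measure_decseq) (auto simp: decseq_def V_def)
    moreover have "(\<Inter>k. V n k) = Y' n"
    proof -
      have "(\<Inter>k. V n k) \<subseteq> Y' n"
      proof
        fix y assume y: "y \<in> (\<Inter>k. V n k)"
        have "y \<in> Y i" if "n \<le> i" for i
        proof -
          have "y \<in> V n (i - n)" using y by blast
          then show ?thesis using that unfolding V_def by auto
        qed
        then show "y \<in> Y' n" unfolding Y'_def by blast
      qed
      moreover have "Y' n \<subseteq> (\<Inter>k. V n k)" by (auto simp: V_def Y'_def)
      ultimately show ?thesis by blast
    qed
    ultimately show "(\<lambda>k. measure \<mu> (U n k) + measure \<nu> (V n k)) \<longlonglongrightarrow> measure \<mu> (X' n) + measure \<nu> (Y' n)"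
      by (auto intro: tendsto_add)
  qed (use val in auto)
  have "measure \<mu> (\<Inter>n. X' n) + measure \<nu> (\<Union>n. Y' n) \<le> c"
  proof (rule LIMSEQ_le)
    show "(\<lambda>n. measure \<mu> (X' n) + measure \<nu> (Y' n)) \<longlonglongrightarrow> measure \<mu> (\<Inter>n. X' n) + measure \<nu> (\<Union>n. Y' n)"
    proof (intro tendsto_add \<mu>.finite_Lim_measure_decseq \<nu>.finite_Lim_measure_incseq)
      show "decseq X'" unfolding decseq_def X'_def by (intro allI impI UN_mono) auto
      show "incseq Y'" unfolding incseq_def Y'_def by (intro allI impI INT_anti_mono) auto
    qed auto
    show "(\<lambda>n. c + 2 * (1/2)^n) \<longlonglongrightarrow> c"
      by (auto intro!: tendsto_eq_intros LIMSEQ_power_zero)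
  qed (use val' in auto)
  moreover have "covers (\<Inter>n. X' n) (\<Union>n. Y' n) (\<Union>n. A n)"
  proof -
    \<comment> \<open>A point \<open>y\<close> outside the limit inferior misses infinitely many
      \<open>Y i\<close>, and for each such \<open>i \<ge> m\<close> the point \<open>x\<close> has
      to lie in \<open>X i\<close>.\<close>
    have "x \<in> (\<Inter>n. X' n) \<or> y \<in> (\<Union>n. Y' n)" if "(x, y) \<in> A m" for x y m
    proof (rule disjCI)
      assume "y \<notin> (\<Union>n. Y' n)"
      then have *: "\<exists>i\<ge>n. y \<notin> Y i" for n by (auto simp: Y'_def)
      show "x \<in> (\<Inter>n. X' n)"
      proof
        fix n
        from *[of "max m n"] obtain i where i: "i \<ge> max m n" "y \<notin> Y i" by blast
        then have "(x, y) \<in> A i" using that incseqD[OF A, of m i] by auto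
        then have "x \<in> X i" using XY(1)[of i] i by (auto simp: covers_def)
        then show "x \<in> X' n" using i by (auto simp: X'_def)
      qed
    qed
    then have "(\<Union>n. A n) \<subseteq> (\<Inter>n. X' n) \<times> UNIV \<union> UNIV \<times> (\<Union>n. Y' n)"
      unfolding subset_iff mem_Times_iff Un_iff by (metis UNIV_I UN_iff surjective_pairing)
    then show ?thesis unfolding covers_def by (intro conjI; (assumption | measurable))
  qed
  ultimately show ?thesis using that by blast
qed

text \<open>Applying \<open>cover_Union\<close> to a constant sequence turns near-optimal covers
  into an optimal one.\<close>

lemma cap_attained:
  obtains X Y where "covers X Y A" "measure \<mu> X + measure \<nu> Y = cap A"
proof -
  obtain X Y where "covers X Y (\<Union>n::nat. A)" "measure \<mu> X + measure \<nu> Y \<le> cap A"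
    by (rule cover_Union[of "\<lambda>_. A" "cap A"]) auto
  then show ?thesis using that cap_le[of X Y A] by auto
qed

text \<open>Continuity from below along arbitrary increasing sequences. With \<open>cap_mono\<close>
  and \<open>cap_open\<close> it is what Choquet's argument asks of a capacity.\<close>

lemma cap_Union_le:
  assumes "incseq A" "\<And>n. cap (A n) \<le> c"
  shows "cap (\<Union>n. A n) \<le> c"
  using cover_Union[OF assms] cap_le by (metis order_trans)

text \<open>Outer regularity enlarges both sides of a near-optimal cover to open sets, and the
  region that these cover is open itself.\<close>

lemma cap_open:
  assumes "cap A < c"
  obtains U where "open U" "A \<subseteq> U" "cap U < c"
proof -
  obtain X Y where XY: "covers X Y A" "measure \<mu> X + measure \<nu> Y < c"
    using cap_lessE[OF assms] .
  define e where "e = (c - (measure \<mu> X + measure \<nu> Y)) / 2"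
  have "e > 0" using XY by (simp add: e_def)
  obtain X' where X': "open X'" "X \<subseteq> X'" "measure \<mu> X' < measure \<mu> X + e"
    using open_outer[of \<mu> X e] \<open>e > 0\<close> XY \<mu>.prob_space_axioms by (auto simp: covers_def)
  obtain Y' where Y': "open Y'" "Y \<subseteq> Y'" "measure \<nu> Y' < measure \<nu> Y + e"
    using open_outer[of \<nu> Y e] \<open>e > 0\<close> XY \<nu>.prob_space_axioms by (auto simp: covers_def)
  have "open (X' \<times> UNIV \<union> UNIV \<times> Y')" using X' Y' by (intro open_Un open_Times) auto
  moreover have "A \<subseteq> X' \<times> UNIV \<union> UNIV \<times> Y'" using XY(1) X' Y' by (auto simp: covers_def)
  moreover have "cap (X' \<times> UNIV \<union> UNIV \<times> Y') < c"
  proof -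
    have "cap (X' \<times> UNIV \<union> UNIV \<times> Y') \<le> measure \<mu> X' + measure \<nu> Y'"
      using X' Y' by (intro cap_le) (auto simp: covers_def)
    also have "\<dots> < c" using X' Y' by (simp add: e_def field_simps)
    finally show ?thesis .
  qed
  ultimately show ?thesis using that by blast
qed

end

section \<open>Capacitability of Borel sets\<close>

text \<open>Convergent subsequences are not guaranteed in the large product of intervals used later
  for limits of set functions. Limits are therefore taken as cluster points and controlled only
  through closed conditions.\<close>

lemma cluster_point:
  fixes x :: "nat \<Rightarrow> 'a::topological_space"
  assumes "compact U" "\<And>n. x n \<in> U"
  obtains l where "l \<in> U" "\<And>S. closed S \<Longrightarrow> eventually (\<lambda>n. x n \<in> S) sequentially \<Longrightarrow> l \<in> S"
proof -
  have "filtermap x sequentially \<noteq> bot" by (simp add: filtermap_bot_iff)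
  moreover have "eventually (\<lambda>y. y \<in> U) (filtermap x sequentially)"
    using assms(2) by (simp add: eventually_filtermap)
  ultimately obtain l where l: "l \<in> U" "inf (nhds l) (filtermap x sequentially) \<noteq> bot"
    using assms(1) unfolding compact_filter by blast
  have "l \<in> S" if "closed S" "eventually (\<lambda>n. x n \<in> S) sequentially" for S
  proof (rule ccontr)
    assume "l \<notin> S"
    then have "eventually (\<lambda>y. y \<in> - S) (nhds l)"
      using that(1) by (intro eventually_nhds_in_open) auto
    moreover have "eventually (\<lambda>y. y \<in> S) (filtermap x sequentially)"
      using that(2) by (simp add: eventually_filtermap)
    ultimately have "eventually (\<lambda>_. False) (inf (nhds l) (filtermap x sequentially))"
      unfolding eventually_inf by blast
    then show False using l(2) by (simp add: trivial_limit_def)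
  qed
  with l(1) show ?thesis using that by blast
qed

text \<open>Analytic sets, presented as projections along Baire space. With closed subsets of the
  product, unlike with continuous images of Baire space, the empty set needs no separate
  clause.\<close>

definition analytic_set :: "'b::topological_space set \<Rightarrow> bool" where
  "analytic_set A \<longleftrightarrow> (\<exists>F :: ('b \<times> (nat \<Rightarrow> nat)) set. closed F \<and> A = fst ` F)"

lemma closed_analytic: "closed A \<Longrightarrow> analytic_set A"
  unfolding analytic_set_def by (intro exI[of _ "A \<times> UNIV"]) (auto intro: closed_Times)

lemma continuous_on_apply_fun: "continuous_on UNIV (\<lambda>p. snd p (k::nat))"
  by (rule continuous_on_compose2[OF continuous_on_product_coordinates[of k]])
     (auto intro: continuous_on_snd continuous_on_id)

lemma closed_snd_apply:
  "closed {p :: 'a::topological_space \<times> (nat \<Rightarrow> nat). P (snd p k)}"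
proof -
  have "closed (Collect P :: nat set)" unfolding closed_def by (rule Topological_Spaces.open_discrete)
  then have "closed ((\<lambda>p :: 'a \<times> (nat \<Rightarrow> nat). snd p k) -` Collect P)"
    by (rule closed_vimage[OF _ continuous_on_apply_fun])
  then show ?thesis by (simp add: vimage_def)
qed

text \<open>The first entry of the witnessing sequence selects the index \<open>n\<close>; the
  shifted sequence witnesses membership in \<open>A n\<close>.\<close>

lemma analytic_UN:
  assumes "\<And>n::nat. analytic_set (A n)"
  shows "analytic_set (\<Union>n. A n)"
proof -
  have "\<exists>F. \<forall>n. closed (F n :: ('a \<times> (nat \<Rightarrow> nat)) set) \<and> A n = fst ` F n"
    by (rule choice[OF allI[OF assms[unfolded analytic_set_def]]])
  then obtain F :: "nat \<Rightarrow> ('a \<times> (nat \<Rightarrow> nat)) set" where F: "\<And>n. closed (F n)" "\<And>n. A n = fst ` F n" by blast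
  define G where "G = (\<Inter>n. {(x, s). s 0 \<noteq> n} \<union> (\<lambda>(x, s). (x, \<lambda>k. s (Suc k))) -` F n)"
  have "closed {p :: 'a \<times> (nat \<Rightarrow> nat). snd p 0 \<noteq> n}" for n
    using closed_snd_apply[of "\<lambda>m. m \<noteq> n" 0] .
  moreover have "closed ((\<lambda>(x, s). (x, \<lambda>k. s (Suc k))) -` F n)" for n
    unfolding case_prod_unfold
    by (intro closed_vimage F continuous_on_Pair continuous_on_fst continuous_on_id
        continuous_on_coordinatewise_then_product continuous_on_apply_fun)
  ultimately have "closed G" unfolding G_def case_prod_unfold by (intro closed_INT ballI closed_Un) auto
  moreover have "(\<Union>n. A n) = fst ` G"
  proof (intro equalityI subsetI)
    fix x assume "x \<in> (\<Union>n. A n)"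
    then obtain n s where "(x, s) \<in> F n" by (auto simp: F(2))
    then have "(x, case_nat n s) \<in> G" by (auto simp: G_def)
    then show "x \<in> fst ` G" by force
  next
    fix x assume "x \<in> fst ` G"
    then obtain s where "(x, s) \<in> G" by auto
    then have "(x, \<lambda>k. s (Suc k)) \<in> F (s 0)" by (auto simp: G_def)
    then show "x \<in> (\<Union>n. A n)" by (force simp: F(2))
  qed
  ultimately show ?thesis unfolding analytic_set_def by blast
qed

text \<open>One sequence encodes countably many through \<open>prod_encode\<close>, and so witnesses
  membership in all \<open>A n\<close> at once.\<close>

lemma analytic_INT:
  assumes "\<And>n::nat. analytic_set (A n)"
  shows "analytic_set (\<Inter>n. A n)"
proof -
  have "\<exists>F. \<forall>n. closed (F n :: ('a \<times> (nat \<Rightarrow> nat)) set) \<and> A n = fst ` F n"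
    by (rule choice[OF allI[OF assms[unfolded analytic_set_def]]])
  then obtain F :: "nat \<Rightarrow> ('a \<times> (nat \<Rightarrow> nat)) set" where F: "\<And>n. closed (F n)" "\<And>n. A n = fst ` F n" by blast
  define G where "G = (\<Inter>n. (\<lambda>(x, s). (x, \<lambda>k. s (prod_encode (n, k)))) -` F n)"
  have "closed ((\<lambda>(x, s). (x, \<lambda>k. s (prod_encode (n, k)))) -` F n)" for n
    unfolding case_prod_unfold
    by (intro closed_vimage F continuous_on_Pair continuous_on_fst continuous_on_id
        continuous_on_coordinatewise_then_product continuous_on_apply_fun)
  then have "closed G" unfolding G_def by (intro closed_INT) auto
  moreover have "(\<Inter>n. A n) = fst ` G"
  proof (intro equalityI subsetI)
    fix x assume "x \<in> (\<Inter>n. A n)"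
    then have "\<forall>n. \<exists>s. (x, s) \<in> F n" by (force simp: F(2))
    then obtain s where "\<And>n. (x, s n) \<in> F n" by metis
    then have "(x, \<lambda>m. s (fst (prod_decode m)) (snd (prod_decode m))) \<in> G" by (auto simp: G_def)
    then show "x \<in> fst ` G" by force
  next
    fix x assume "x \<in> fst ` G"
    then show "x \<in> (\<Inter>n. A n)" by (force simp: F(2) G_def)
  qed
  ultimately show ?thesis unfolding analytic_set_def by blast
qed

lemma open_analytic:
  fixes U :: "'b::metric_space set"
  assumes "open U"
  shows "analytic_set U"
proof -
  have "fsigma_in euclidean U"
    using assms by (intro open_imp_fsigma_in metrizable_space_euclidean) auto
  then obtain C where "\<And>n::nat. closed (C n)" "U = (\<Union>n. C n)"
    unfolding fsigma_in_ascending by auto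
  then show ?thesis using analytic_UN[of C] closed_analytic by auto
qed

lemma borel_analytic:
  fixes A :: "'b::metric_space set"
  assumes "A \<in> sets borel"
  shows "analytic_set A"
proof -
  have "A \<in> sigma_sets UNIV {S. open S}" using assms by (simp add: borel_def)
  \<comment> \<open>Complements of analytic sets need not be analytic, so the induction carries the
    complement along; closure under countable unions and intersections then suffices.\<close>
  then have "analytic_set A \<and> analytic_set (- A)"
  proof induction
    case (Basic U)
    then show ?case using open_analytic closed_analytic[of "- U"] by auto
  next
    case Empty
    show ?case using closed_analytic by auto
  next
    case (Compl A)
    then show ?case unfolding Compl_eq_Diff_UNIV[symmetric] by simp
  next
    case (Union A)
    then show ?case using analytic_UN[of A] analytic_INT[of "\<lambda>n. - A n"] by auto
  qed
  then show ?thesis ..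
qed

lemma compact_bounded_sequences: "compact {s :: nat \<Rightarrow> nat. \<forall>i. s i \<le> t i}"
proof -
  have "compactin (product_topology (\<lambda>_. euclidean) UNIV) (PiE UNIV (\<lambda>i. {..t i}))"
    unfolding compactin_PiE by (auto simp: finite_imp_compact)
  moreover have "PiE UNIV (\<lambda>i. {..t i}) = {s. \<forall>i. s i \<le> t i}" by auto
  ultimately show ?thesis by (simp add: euclidean_product_topology)
qed

section \<open>Choquet's capacitability argument\<close>

context marginals
begin

text \<open>The coordinates of the witnessing sequences are bounded one at a time; by continuity
  from below each bound can be chosen large enough to keep the capacity above \<open>c\<close>. Once
  all coordinates are bounded the witnesses form a compact set, and \<open>cap_open\<close> shows
  that its projection still has capacity at least \<open>c\<close>.\<close>

lemma cap_compact_analytic: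
  assumes F: "closed F" "F \<subseteq> D \<times> (UNIV :: (nat \<Rightarrow> nat) set)" and D: "compact D"
    and c: "c < cap (fst ` F)"
  obtains K where "compact K" "K \<subseteq> fst ` F" "c \<le> cap K"
proof -
  define P where "P t n = {s::nat \<Rightarrow> nat. \<forall>i<n. s i \<le> t i}" for t :: "nat \<Rightarrow> nat" and n :: nat
  define Q where "Q t n m \<longleftrightarrow> c < cap (fst ` (F \<inter> UNIV \<times> (P t n \<inter> {s. s n \<le> m})))" for t n m
  have P_Suc: "P t (Suc n) = P t n \<inter> {s. s n \<le> t n}" for t n by (auto simp: P_def less_Suc_eq)
  \<comment> \<open>The choice of the bound \<open>t n\<close> depends on the earlier bounds only,
    since \<open>Q t n\<close> looks at \<open>t\<close> below \<open>n\<close>.\<close>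
  have "\<exists>t. \<forall>n. Q t n (t n)"
  proof (rule dependent_wellorder_choice)
    show "Q f x r = Q g x r" if "\<And>y. y < x \<Longrightarrow> f y = g y" for r f g x
      using that by (simp add: Q_def P_def)
    show "\<exists>r. Q f x r" if IH: "\<And>y. y < x \<Longrightarrow> Q f y (f y)" for x f
    proof (rule ccontr)
      assume "\<nexists>r. Q f x r"
      then have "cap (\<Union>m. fst ` (F \<inter> UNIV \<times> (P f x \<inter> {s. s x \<le> m}))) \<le> c"
      proof (intro cap_Union_le)
        show "incseq (\<lambda>m. fst ` (F \<inter> UNIV \<times> (P f x \<inter> {s. s x \<le> m})))"
          by (intro incseq_SucI image_mono) auto
      qed (auto simp: Q_def not_less)
      moreover have "(\<Union>m. fst ` (F \<inter> UNIV \<times> (P f x \<inter> {s. s x \<le> m}))) = fst ` (F \<inter> UNIV \<times> P f x)"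
        by (auto simp: image_def)
      moreover have "c < cap (fst ` (F \<inter> UNIV \<times> P f x))"
      proof (cases x)
        case 0
        then show ?thesis using c by (simp add: P_def)
      next
        case (Suc y)
        then show ?thesis using IH[of y] by (simp add: Q_def P_Suc)
      qed
      ultimately show False by simp
    qed
  qed
  then obtain t where "\<And>n. Q t n (t n)" by blast
  then have t: "c < cap (fst ` (F \<inter> UNIV \<times> P t (Suc n)))" for n
    by (simp add: Q_def P_Suc)
  define K where "K = fst ` (F \<inter> D \<times> {s. \<forall>i. s i \<le> t i})"
  have "compact (F \<inter> D \<times> {s. \<forall>i. s i \<le> t i})"
    by (intro closed_Int_compact compact_Times D compact_bounded_sequences F)
  then have "compact K" unfolding K_def
    by (intro compact_continuous_image continuous_on_fst continuous_on_id)
  moreover have "K \<subseteq> fst ` F" by (auto simp: K_def)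
  moreover have "c \<le> cap K"
  proof (rule ccontr)
    assume "\<not> c \<le> cap K"
    then obtain U where U: "open U" "K \<subseteq> U" "cap U < c" using cap_open[of K c] by auto
    have "\<not> fst ` (F \<inter> UNIV \<times> P t (Suc n)) \<subseteq> U" for n
      using cap_mono[of _ U] t[of n] U(3) by (meson not_less order.strict_trans2 order.asym)
    then have "\<forall>n. \<exists>z. z \<in> F \<inter> UNIV \<times> P t (Suc n) \<and> fst z \<notin> U" by blast
    from choice[OF this] obtain z
      where "\<forall>n. z n \<in> F \<inter> UNIV \<times> P t (Suc n) \<and> fst (z n) \<notin> U" by blast
    then have z: "\<And>n. z n \<in> F" "\<And>n. snd (z n) \<in> P t (Suc n)" "\<And>n. fst (z n) \<notin> U"
      by (simp_all add: mem_Times_iff)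
    \<comment> \<open>The point \<open>z n\<close> obeys the bounds \<open>t\<close> only in the
      coordinates up to \<open>n\<close>. In each coordinate just finitely many \<open>n\<close> may
      escape, so the larger bounds \<open>t'\<close> put the whole sequence into one compact set,
      while a cluster point still obeys \<open>t\<close>.\<close>
    define t' where "t' i = Max (insert (t i) ((\<lambda>n. snd (z n) i) ` {..i}))" for i
    have "snd (z n) i \<le> t' i" for n i
    proof (cases "n \<le> i")
      case True
      then show ?thesis unfolding t'_def by (intro Max_ge) auto
    next
      case False
      then have "snd (z n) i \<le> t i" using z(2)[of n] by (auto simp: P_def)
      also have "t i \<le> t' i" unfolding t'_def by (intro Max_ge) auto
      finally show ?thesis .
    qed
    then have zD: "z n \<in> D \<times> {s. \<forall>i. s i \<le> t' i}" for n
      using z(1)[of n] F(2) by (auto simp: mem_Times_iff)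
    obtain l where l: "l \<in> D \<times> {s. \<forall>i. s i \<le> t' i}"
      "\<And>S. closed S \<Longrightarrow> eventually (\<lambda>n. z n \<in> S) sequentially \<Longrightarrow> l \<in> S"
      by (rule cluster_point[OF compact_Times[OF D compact_bounded_sequences[of t']], of z]) (use zD in blast)+
    have "l \<in> F" using z(1) by (intro l(2) F) auto
    moreover have "fst l \<notin> U"
    proof -
      have "l \<in> - (U \<times> UNIV)"
        using U(1) z(3) by (intro l(2)) (auto simp: closed_def open_Times mem_Times_iff)
      then show ?thesis by (auto simp: mem_Times_iff)
    qed
    moreover have "snd l i \<le> t i" for i
    proof -
      have "closed {p :: ('a \<times> 'b) \<times> (nat \<Rightarrow> nat). snd p i \<le> t i}"
        using closed_snd_apply[of "\<lambda>m. m \<le> t i" i] .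
      moreover have "eventually (\<lambda>n. z n \<in> {p. snd p i \<le> t i}) sequentially"
        by (rule eventually_mono[OF eventually_ge_at_top[of i]]) (use z(2) in \<open>auto simp: P_def\<close>)
      ultimately show ?thesis using l(2) by blast
    qed
    ultimately have "fst l \<in> K" using l(1) by (auto simp: K_def mem_Times_iff image_iff intro!: bexI[of _ l])
    with \<open>fst l \<notin> U\<close> U(2) show False by blast
  qed
  ultimately show ?thesis using that by blast
qed

text \<open>Tightness of both marginals confines \<open>E\<close> to a compact rectangle at a cost
  below \<open>e\<close>, which supplies the compact set \<open>D\<close> of
  \<open>cap_compact_analytic\<close>.\<close>

lemma cap_compact:
  assumes E: "E \<in> sets borel" and "0 < e"
  obtains K where "compact K" "K \<subseteq> E" "cap E - e \<le> cap K"
proof -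
  obtain D where D: "compact D" "1 - e/3 < measure \<mu> D"
    using compact_inner[of \<mu> UNIV "e/3"] \<open>0 < e\<close> \<mu>.prob_space_axioms \<mu>.prob_space by auto
  obtain D' where D': "compact D'" "1 - e/3 < measure \<nu> D'"
    using compact_inner[of \<nu> UNIV "e/3"] \<open>0 < e\<close> \<nu>.prob_space_axioms \<nu>.prob_space by auto
  have [simp]: "D \<in> sets borel" "D' \<in> sets borel" using D D' by (auto intro: borel_closed compact_imp_closed)
  have "measure \<mu> (- D) < e/3" "measure \<nu> (- D') < e/3"
    unfolding Compl_eq_Diff_UNIV using D D' \<mu>.prob_compl[of D] \<nu>.prob_compl[of D'] by simp_all
  with cap_add_cover[of D D' E] have c: "cap E - e < cap (E \<inter> D \<times> D')" using \<open>0 < e\<close> by simp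
  obtain F0 :: "(('a \<times> 'b) \<times> (nat \<Rightarrow> nat)) set" where F0: "closed F0" "E = fst ` F0" using borel_analytic[OF E] unfolding analytic_set_def by blast
  define F where "F = F0 \<inter> (D \<times> D') \<times> UNIV"
  have F: "fst ` F = E \<inter> D \<times> D'" by (auto simp: F_def F0(2) image_iff Bex_def)
  have "closed F" unfolding F_def
    by (intro closed_Int F0 closed_Times compact_imp_closed D D') auto
  moreover have "F \<subseteq> (D \<times> D') \<times> UNIV" by (auto simp: F_def)
  ultimately obtain K where "compact K" "K \<subseteq> fst ` F" "cap E - e \<le> cap K"
    by (rule cap_compact_analytic[OF _ _ compact_Times[OF D(1) D'(1)] c[folded F]])
  then show ?thesis using F by (intro that[of K]) auto
qed

section \<open>Duality for compact sets\<close>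

text \<open>
  A finitely additive coupling is inner regular on rectangles because its marginals are, hence
  countably additive on the algebra of sets that are inner regular together with their complements.
\<close>

lemma coupling_of_content:
  fixes g :: "('a \<times> 'b) set \<Rightarrow> real"
  assumes pos: "\<And>W. W \<in> sets borel \<Longrightarrow> 0 \<le> g W"
    and add: "\<And>V W. V \<in> sets borel \<Longrightarrow> W \<in> sets borel \<Longrightarrow> V \<inter> W = {} \<Longrightarrow> g (V \<union> W) = g V + g W"
    and fst_marg: "\<And>A. A \<in> sets borel \<Longrightarrow> g (A \<times> UNIV) = measure \<mu> A"
    and snd_marg: "\<And>B. B \<in> sets borel \<Longrightarrow> g (UNIV \<times> B) = measure \<nu> B"
  obtains P where "prob_space P" "sets P = sets borel"
    "\<forall>\<R>. finite \<R> \<longrightarrow> \<R> \<subseteq> {A \<times> B | A B. A \<in> sets borel \<and> B \<in> sets borel} \<longrightarrow> measure P (\<Union>\<R>) = g (\<Union>\<R>)"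
proof -
  note borel_Times [measurable]
  have g_empty: "g {} = 0" using add[of "{}" "{}"] by simp
  have g_UNIV: "g UNIV = 1" using fst_marg[of UNIV] \<mu>.prob_space by simp
  have g_mono: "g V \<le> g W" if "V \<subseteq> W" "V \<in> sets borel" "W \<in> sets borel" for V W
    using add[of V "W - V"] pos[of "W - V"] that by (simp add: Un_absorb1)
  have g_sub: "g (V \<union> W) \<le> g V + g W" if "V \<in> sets borel" "W \<in> sets borel" for V W
    using add[of V "W - V"] g_mono[of "W - V" W] that by simp
  define reg where "reg W \<longleftrightarrow> (\<forall>e>0. \<exists>K. compact K \<and> K \<subseteq> W \<and> g (W - K) < e)" for W
  have cb [measurable]: "compact K \<Longrightarrow> K \<in> sets borel" for K :: "('a \<times> 'b) set"
    by (intro borel_closed compact_imp_closed)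
  have cb_a: "compact K \<Longrightarrow> K \<in> sets borel" for K :: "'a set"
    by (intro borel_closed compact_imp_closed)
  have cb_b: "compact K \<Longrightarrow> K \<in> sets borel" for K :: "'b set"
    by (intro borel_closed compact_imp_closed)
  have reg_Times: "reg (A \<times> B)" if [measurable]: "A \<in> sets borel" "B \<in> sets borel" for A B
    unfolding reg_def
  proof (intro allI impI)
    fix e :: real assume "0 < e"
    obtain K where K: "compact K" "K \<subseteq> A" "measure \<mu> A - e/2 < measure \<mu> K"
      using compact_inner[of \<mu> A "e/2"] \<open>0 < e\<close> \<mu>.prob_space_axioms by auto
    obtain L where L: "compact L" "L \<subseteq> B" "measure \<nu> B - e/2 < measure \<nu> L"
      using compact_inner[of \<nu> B "e/2"] \<open>0 < e\<close> \<nu>.prob_space_axioms by auto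
    note [measurable] = cb_a[OF K(1)] cb_b[OF L(1)]
    \<comment> \<open>A point of the rectangle outside \<open>K \<times> L\<close> fails in one
      coordinate, so the error is controlled by the marginals, which are genuine measures.\<close>
    have "g (A \<times> B - K \<times> L) \<le> g ((A - K) \<times> UNIV \<union> UNIV \<times> (B - L))"
      by (intro g_mono) auto
    also have "\<dots> \<le> g ((A - K) \<times> UNIV) + g (UNIV \<times> (B - L))" by (intro g_sub) auto
    also have "\<dots> = measure \<mu> (A - K) + measure \<nu> (B - L)" by (simp add: fst_marg snd_marg)
    also have "\<dots> < e"
      using K L by (simp add: \<mu>.finite_measure_Diff \<nu>.finite_measure_Diff)
    finally show "\<exists>K. compact K \<and> K \<subseteq> A \<times> B \<and> g (A \<times> B - K) < e"
      using K L by (intro exI[of _ "K \<times> L"]) (auto intro: compact_Times)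
  qed
  have reg2: "reg (V \<union> W) \<and> reg (V \<inter> W)"
    if VW: "reg V" "reg W" and [measurable]: "V \<in> sets borel" "W \<in> sets borel" for V W
  proof -
    have "\<exists>K L. compact K \<and> compact L \<and> K \<subseteq> V \<and> L \<subseteq> W \<and> g (V - K) + g (W - L) < e" if "0 < e" for e
    proof -
      obtain K where K: "compact K" "K \<subseteq> V" "g (V - K) < e/2"
        using VW(1) \<open>0 < e\<close> unfolding reg_def by (meson half_gt_zero)
      obtain L where L: "compact L" "L \<subseteq> W" "g (W - L) < e/2"
        using VW(2) \<open>0 < e\<close> unfolding reg_def by (meson half_gt_zero)
      show ?thesis using K L by (intro exI[of _ K] exI[of _ L]) auto
    qed
    moreover have "g ((V \<union> W) - (K \<union> L)) \<le> g (V - K) + g (W - L)"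
      "g ((V \<inter> W) - (K \<inter> L)) \<le> g (V - K) + g (W - L)" if "compact K" "compact L" for K L
    proof -
      have [measurable]: "K \<in> sets borel" "L \<in> sets borel" using that by (auto intro: cb)
      have *: "g ((V - K) \<union> (W - L)) \<le> g (V - K) + g (W - L)" by (intro g_sub) auto
      have "g ((V \<union> W) - (K \<union> L)) \<le> g ((V - K) \<union> (W - L))" by (intro g_mono) auto
      with * show "g ((V \<union> W) - (K \<union> L)) \<le> g (V - K) + g (W - L)" by simp
      have "g ((V \<inter> W) - (K \<inter> L)) \<le> g ((V - K) \<union> (W - L))" by (intro g_mono) auto
      with * show "g ((V \<inter> W) - (K \<inter> L)) \<le> g (V - K) + g (W - L)" by simp
    qed
    ultimately show ?thesis unfolding reg_def
      by (meson Int_mono Un_mono compact_Int compact_Un order_le_less_trans)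
  qed
  \<comment> \<open>Regularity of the complement is demanded so that the family is closed under
    complements; for unions \<open>reg2\<close> is applied both to the sets and to their
    complements.\<close>
  define \<A> where "\<A> = {W \<in> sets borel. reg W \<and> reg (- W)}"
  have rect: "A \<times> B \<in> \<A>" if [measurable]: "A \<in> sets borel" "B \<in> sets borel" for A B
  proof -
    have "- (A \<times> B) = (- A) \<times> UNIV \<union> UNIV \<times> (- B)" by auto
    moreover have "reg ((- A) \<times> UNIV)" "reg (UNIV \<times> (- B))" by (intro reg_Times; measurable)+
    ultimately have "reg (- (A \<times> B))" using reg2[of "(- A) \<times> UNIV" "UNIV \<times> (- B)"] by simp
    then show ?thesis unfolding \<A>_def using reg_Times[OF that] by simp
  qed
  have alg: "algebra UNIV \<A>"
    unfolding algebra_iff_Un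
  proof (intro conjI ballI)
    show "{} \<in> \<A>" using rect[of "{}" "{}"] by simp
    show "UNIV - W \<in> \<A>" if "W \<in> \<A>" for W
      using that by (auto simp: \<A>_def simp flip: Compl_eq_Diff_UNIV)
    show "V \<union> W \<in> \<A>" if "V \<in> \<A>" "W \<in> \<A>" for V W
      using that reg2[of V W] reg2[of "- V" "- W"] by (auto simp: \<A>_def)
  qed simp
  interpret algebra UNIV \<A> by (rule alg)
  have \<A>_borel: "W \<in> sets borel" if "W \<in> \<A>" for W using that by (simp add: \<A>_def)
  have "\<exists>m :: ('a \<times> 'b) set \<Rightarrow> ennreal. (\<forall>W\<in>\<A>. m W = ennreal (g W)) \<and> measure_space UNIV (sigma_sets UNIV \<A>) m"
  proof (rule caratheodory_empty_continuous)
    show "positive \<A> (\<lambda>W. ennreal (g W))" by (simp add: positive_def g_empty)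
    show "additive \<A> (\<lambda>W. ennreal (g W))"
      unfolding additive_def using \<A>_borel pos add by (simp add: ennreal_plus)
    fix A :: "nat \<Rightarrow> ('a \<times> 'b) set"
    assume A: "range A \<subseteq> \<A>" "decseq A" "(\<Inter>i. A i) = {}"
    have [measurable]: "A i \<in> sets borel" for i using A(1) \<A>_borel by auto
    have "(\<lambda>i. g (A i)) \<longlonglongrightarrow> 0"
    proof (rule LIMSEQ_I)
      fix e :: real assume "0 < e"
      have "\<exists>K. compact K \<and> K \<subseteq> A i \<and> g (A i - K) < e * (1/2)^(Suc i)" for i
      proof -
        have "reg (A i)" using A(1) by (auto simp: \<A>_def)
        moreover have "0 < e * (1/2)^(Suc i)" using \<open>0 < e\<close> by simp
        ultimately show ?thesis unfolding reg_def by blast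
      qed
      then obtain K where K: "\<And>i. compact (K i)" "\<And>i. K i \<subseteq> A i" "\<And>i. g (A i - K i) < e * (1/2)^(Suc i)"
        by metis
      have [measurable]: "K i \<in> sets borel" for i using K(1) by (rule cb)
      \<comment> \<open>The compact sets \<open>K i\<close> need not decrease with the
        \<open>A i\<close>, hence the finite intersections; the geometric errors keep the total loss
        below \<open>e\<close>.\<close>
      have tail: "g (A n - (\<Inter>i\<le>n. K i)) < e * (1 - (1/2)^(Suc n))" for n
      proof (induction n)
        case 0
        show ?case using K(3)[of 0] by simp
      next
        case (Suc n)
        have "g (A (Suc n) - (\<Inter>i\<le>Suc n. K i)) \<le> g ((A n - (\<Inter>i\<le>n. K i)) \<union> (A (Suc n) - K (Suc n)))"
          using decseqD[OF A(2), of n "Suc n"] by (intro g_mono) (auto simp: le_Suc_eq)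
        also have "\<dots> \<le> g (A n - (\<Inter>i\<le>n. K i)) + g (A (Suc n) - K (Suc n))"
          by (intro g_sub) auto
        also have "\<dots> < e * (1 - (1/2)^(Suc n)) + e * (1/2)^(Suc (Suc n))"
          using Suc K(3)[of "Suc n"] by (rule add_strict_mono)
        also have "\<dots> = e * (1 - (1/2)^(Suc (Suc n)))" by (simp add: algebra_simps)
        finally show ?case .
      qed
      \<comment> \<open>By compactness the empty intersection of all \<open>K i\<close> is empty at
        a finite stage already, and from there on \<open>tail\<close> bounds \<open>g (A n)\<close>
        itself.\<close>
      have "\<exists>N. (\<Inter>i\<le>N. K i) = {}"
      proof (rule ccontr)
        assume *: "\<nexists>N. (\<Inter>i\<le>N. K i) = {}"
        have "K 0 \<inter> (\<Inter>i\<in>UNIV. K i) \<noteq> {}"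
        proof (rule compact_imp_fip_image)
          fix I :: "nat set" assume I: "finite I"
          have "(\<Inter>i\<le>Max (insert 0 I). K i) \<subseteq> K 0 \<inter> (\<Inter>i\<in>I. K i)"
            using I by (intro Int_greatest INT_greatest INT_lower) auto
          moreover have "(\<Inter>i\<le>Max (insert 0 I). K i) \<noteq> {}" using * by blast
          ultimately show "K 0 \<inter> (\<Inter>i\<in>I. K i) \<noteq> {}" by blast
        qed (rule K(1), rule compact_imp_closed[OF K(1)])
        then obtain x where "x \<in> (\<Inter>i. K i)" by blast
        then have "x \<in> (\<Inter>i. A i)" using K(2) by blast
        then show False using A(3) by blast
      qed
      then obtain N where N: "(\<Inter>i\<le>N. K i) = {}" by blast
      have "norm (g (A n) - 0) < e" if "N \<le> n" for n
      proof -
        have "(\<Inter>i\<le>n. K i) \<subseteq> (\<Inter>i\<le>N. K i)" using that by (intro INT_anti_mono) auto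
        then have "(\<Inter>i\<le>n. K i) = {}" by (simp only: N subset_empty)
        with tail[of n] have "g (A n) < e * (1 - (1/2)^(Suc n))" by (metis Diff_empty)
        also have "\<dots> \<le> e * 1" using \<open>0 < e\<close> by (intro mult_left_mono) auto
        finally show ?thesis using pos[of "A n"] by simp
      qed
      then show "\<exists>N. \<forall>n\<ge>N. norm (g (A n) - 0) < e" by blast
    qed
    from tendsto_ennrealI[OF this] show "(\<lambda>i. ennreal (g (A i))) \<longlonglongrightarrow> 0" by simp
  qed simp
  then obtain m where "\<forall>W\<in>\<A>. m W = ennreal (g W)" and m_space: "measure_space UNIV (sigma_sets UNIV \<A>) m"
    by (elim exE conjE)
  then have m: "\<And>W. W \<in> \<A> \<Longrightarrow> m W = ennreal (g W)" by blast
  have sigma: "sigma_sets UNIV \<A> = sets borel"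
  proof
    show "sigma_sets UNIV \<A> \<subseteq> sets borel"
      using sets.sigma_sets_subset[of \<A> borel] \<A>_borel by auto
    have "sets (borel :: ('a \<times> 'b) measure) = sets (borel \<Otimes>\<^sub>M borel)"
      by (rule arg_cong[OF borel_prod[symmetric]])
    also have "\<dots> = sigma_sets UNIV {A \<times> B | A B. A \<in> sets borel \<and> B \<in> sets borel}"
      by (simp add: sets_pair_measure)
    also have "\<dots> \<subseteq> sigma_sets UNIV \<A>" using rect by (intro sigma_sets_mono') auto
    finally show "sets borel \<subseteq> sigma_sets UNIV \<A>" .
  qed
  define P where "P = measure_of UNIV (sets borel) m"
  have sets_P: "sets P = sets borel"
    unfolding P_def using sets.sigma_sets_eq[of "borel :: ('a \<times> 'b) measure"] by simp
  have emeasure_P: "emeasure P W = m W" if "W \<in> sets borel" for W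
    unfolding P_def using m_space that unfolding sigma measure_space_def
    by (intro emeasure_measure_of_sigma) auto
  have measure_P: "measure P W = g W" if "W \<in> \<A>" for W
    using emeasure_P[of W] m[OF that] \<A>_borel[OF that] pos[of W] by (simp add: measure_def)
  have "prob_space P"
  proof
    have "UNIV \<in> \<A>" using rect[of UNIV UNIV] by simp
    moreover have "space P = UNIV" using sets_eq_imp_space_eq[OF sets_P] by simp
    ultimately show "emeasure P (space P) = 1" using emeasure_P[of UNIV] m[of UNIV] g_UNIV by simp
  qed
  \<comment> \<open>On other Borel sets \<open>P\<close> may differ from \<open>g\<close>, which
    need not be countably additive there; agreement on the algebra is all that the construction
    provides.\<close>
  moreover have "\<forall>\<R>. finite \<R> \<longrightarrow> \<R> \<subseteq> {A \<times> B | A B. A \<in> sets borel \<and> B \<in> sets borel} \<longrightarrow>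
      measure P (\<Union>\<R>) = g (\<Union>\<R>)"
    using rect by (auto intro!: measure_P finite_Union)
  ultimately show ?thesis by (rule that[OF _ sets_P])
qed

section \<open>Couplings adapted to finite measurable partitions\<close>

lemma sets_pair [simp]: "sets (\<mu> \<Otimes>\<^sub>M \<nu>) = sets borel"
  by (metis borel_prod sets_\<mu> sets_\<nu> sets_pair_measure_cong)

text \<open>The maps \<open>c\<close> and \<open>d\<close> cut both spaces into finitely many cells.
  \<open>finite_coupling\<close> distributes mass over the pairs of cells, and inside each pair a
  rescaled product measure restores the exact marginals. Only finite additivity is recorded, since a
  pointwise limit is guaranteed to keep no more than that.\<close>

lemma discrete_coupling:
  fixes c :: "'a \<Rightarrow> 'i" and d :: "'b \<Rightarrow> 'j"
  assumes c [measurable]: "c \<in> borel \<rightarrow>\<^sub>M count_space I" and d [measurable]: "d \<in> borel \<rightarrow>\<^sub>M count_space J"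
    and fin: "finite I" "finite J"
  shows "\<exists>g. (\<forall>W\<in>sets borel. 0 \<le> g W) \<and>
    (\<forall>V\<in>sets borel. \<forall>W\<in>sets borel. V \<inter> W = {} \<longrightarrow> g (V \<union> W) = g V + g W) \<and>
    (\<forall>A\<in>sets borel. g (A \<times> UNIV) = measure \<mu> A) \<and> (\<forall>B\<in>sets borel. g (UNIV \<times> B) = measure \<nu> B) \<and>
    (\<forall>W\<in>sets borel. map_prod c d ` W \<inter> map_prod c d ` K = {} \<longrightarrow> g W \<le> 1 - cap K)"
proof -
  have cI: "c x \<in> I" and dJ: "d y \<in> J" for x y
    using measurable_space[OF c] measurable_space[OF d] by auto
  define cc where "cc s = {x. c x = s}" for s
  define dd where "dd t = {y. d y = t}" for t
  have cS [measurable]: "{x. c x \<in> S} \<in> sets borel" for S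
    using measurable_sets[OF c, of "S \<inter> I"] cI by (auto simp: vimage_def)
  have [measurable]: "{y. d y \<in> S} \<in> sets borel" for S
    using measurable_sets[OF d, of "S \<inter> J"] dJ by (auto simp: vimage_def)
  have cc [measurable]: "cc s \<in> sets borel" for s unfolding cc_def
    using \<open>{x. c x \<in> {s}} \<in> sets borel\<close> by simp
  have dd [measurable]: "dd t \<in> sets borel" for t unfolding dd_def
    using \<open>{x. d x \<in> {t}} \<in> sets borel\<close> by simp
  define a where "a s = measure \<mu> (cc s)" for s
  define b where "b t = measure \<nu> (dd t)" for t
  define R where "R s t \<longleftrightarrow> (s, t) \<in> map_prod c d ` K" for s t
  have split_\<mu>: "(\<Sum>s\<in>S. measure \<mu> (A \<inter> cc s)) = measure \<mu> (A \<inter> {x. c x \<in> S})"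
    if "finite S" "A \<in> sets borel" for S A
  proof -
    have "measure \<mu> (\<Union>s\<in>S. A \<inter> cc s) = (\<Sum>s\<in>S. measure \<mu> (A \<inter> cc s))"
      using that by (intro \<mu>.finite_measure_finite_Union) (auto simp: disjoint_family_on_def cc_def[abs_def] cc[unfolded cc_def])
    moreover have "(\<Union>s\<in>S. A \<inter> cc s) = A \<inter> {x. c x \<in> S}" by (auto simp: cc_def)
    ultimately show ?thesis by simp
  qed
  have split_\<nu>: "(\<Sum>s\<in>S. measure \<nu> (A \<inter> dd s)) = measure \<nu> (A \<inter> {x. d x \<in> S})"
    if "finite S" "A \<in> sets borel" for S A
  proof -
    have "measure \<nu> (\<Union>s\<in>S. A \<inter> dd s) = (\<Sum>s\<in>S. measure \<nu> (A \<inter> dd s))"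
      using that by (intro \<nu>.finite_measure_finite_Union) (auto simp: disjoint_family_on_def dd_def[abs_def] dd[unfolded dd_def])
    moreover have "(\<Union>s\<in>S. A \<inter> dd s) = A \<inter> {x. d x \<in> S}" by (auto simp: dd_def)
    ultimately show ?thesis by simp
  qed
  have sum_a: "sum a S = measure \<mu> {x. c x \<in> S}" if "finite S" for S
    using split_\<mu>[OF that, of UNIV] by (simp add: a_def)
  have sum_b: "sum b S = measure \<nu> {x. d x \<in> S}" if "finite S" for S
    using split_\<nu>[OF that, of UNIV] by (simp add: b_def)
  have tot_a: "sum a I = 1" and tot_b: "sum b J = 1"
    using sum_a[OF fin(1)] sum_b[OF fin(2)] cI dJ \<mu>.prob_space \<nu>.prob_space by auto
  have "\<exists>q. (\<forall>i j. 0 \<le> q i j) \<and> (\<forall>i\<in>I. (\<Sum>j\<in>J. q i j) = a i) \<and>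
     (\<forall>j\<in>J. (\<Sum>i\<in>I. q i j) = b j) \<and> sum a I - (1 - cap K) \<le> (\<Sum>i\<in>I. \<Sum>j\<in>{j\<in>J. R i j}. q i j)"
  proof (rule finite_coupling)
    fix S assume S: "S \<subseteq> I"
    define N where "N = {j\<in>J. \<exists>i\<in>S. R i j}"
    have fS: "finite S" and fN: "finite N" using S fin finite_subset[of S I] by (auto simp: N_def)
    \<comment> \<open>This cover turns the definition of \<open>cap K\<close> into a Hall condition
      with deficiency \<open>1 - cap K\<close>.\<close>
    have "covers {x. c x \<in> - S} {y. d y \<in> N} K"
    proof -
      have "d y \<in> N" if "(x, y) \<in> K" "c x \<in> S" for x y
      proof -
        have "map_prod c d (x, y) \<in> map_prod c d ` K" using that(1) by (rule imageI)
        then show ?thesis using that dJ by (auto simp: N_def R_def)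
      qed
      then show ?thesis using cS[of "- S"] by (auto simp: covers_def)
    qed
    then have "cap K \<le> measure \<mu> {x. c x \<in> - S} + measure \<nu> {y. d y \<in> N}" by (rule cap_le)
    moreover have "measure \<mu> {x. c x \<in> - S} = 1 - sum a S"
      using \<mu>.prob_compl[of "{x. c x \<in> S}"] sum_a[OF fS] by (simp add: Compl_eq_Diff_UNIV[symmetric] Collect_neg_eq)
    ultimately show "sum a S \<le> sum b {j\<in>J. \<exists>i\<in>S. R i j} + (1 - cap K)"
      using sum_b[OF fN] by (simp add: N_def)
  qed (use fin tot_a tot_b cap_le_1 in \<open>auto simp: a_def b_def\<close>)
  then obtain q where "\<forall>s t. 0 \<le> q s t" "\<forall>s\<in>I. (\<Sum>t\<in>J. q s t) = a s"
    "\<forall>t\<in>J. (\<Sum>s\<in>I. q s t) = b t" and qR': "sum a I - (1 - cap K) \<le> (\<Sum>s\<in>I. \<Sum>t\<in>{t\<in>J. R s t}. q s t)"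
    by (elim exE conjE)
  then have q0: "\<And>s t. 0 \<le> q s t" and qa: "\<And>s. s \<in> I \<Longrightarrow> (\<Sum>t\<in>J. q s t) = a s"
    and qb: "\<And>t. t \<in> J \<Longrightarrow> (\<Sum>s\<in>I. q s t) = b t" by auto
  have qR: "cap K \<le> (\<Sum>s\<in>I. \<Sum>t\<in>{t\<in>J. R s t}. q s t)" using qR' tot_a by simp
  have qa0: "q s t = 0" if "a s = 0" "s \<in> I" "t \<in> J" for s t
    using qa[OF that(2)] that q0 fin by (simp add: sum_nonneg_eq_0_iff)
  have qb0: "q s t = 0" if "b t = 0" "s \<in> I" "t \<in> J" for s t
    using qb[OF that(3)] that q0 fin by (simp add: sum_nonneg_eq_0_iff)
  interpret P: pair_prob_space \<mu> \<nu> ..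
  \<comment> \<open>Cells with \<open>a s * b t = 0\<close> carry no weight \<open>q s t\<close>, so the division by zero there is harmless.\<close>
  define w where "w s t W = q s t / (a s * b t) * measure (\<mu> \<Otimes>\<^sub>M \<nu>) (W \<inter> cc s \<times> dd t)" for s t W
  define g where "g W = (\<Sum>s\<in>I. \<Sum>t\<in>J. w s t W)" for W
  have a0: "0 \<le> a s" and b0: "0 \<le> b t" for s t by (simp_all add: a_def b_def)
  have w0: "0 \<le> w s t W" for s t W using q0 a0 b0 by (simp add: w_def)
  have prod_measure: "measure (\<mu> \<Otimes>\<^sub>M \<nu>) (A \<times> B) = measure \<mu> A * measure \<nu> B"
    if "A \<in> sets borel" "B \<in> sets borel" for A B
    using that by (simp add: measure_def \<nu>.emeasure_pair_measure_Times enn2real_mult)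
  have w_le: "w s t W \<le> q s t" if "s \<in> I" "t \<in> J" "W \<in> sets borel" for s t W
  proof (cases "a s = 0 \<or> b t = 0")
    case True
    then show ?thesis using qa0 qb0 that by (auto simp: w_def)
  next
    case False
    have "measure (\<mu> \<Otimes>\<^sub>M \<nu>) (W \<inter> cc s \<times> dd t) \<le> measure (\<mu> \<Otimes>\<^sub>M \<nu>) (cc s \<times> dd t)"
      by (intro P.finite_measure_mono) (auto intro: borel_Times)
    then have "w s t W \<le> q s t / (a s * b t) * (a s * b t)"
      unfolding w_def using q0 a0 b0 by (intro mult_left_mono) (auto simp: prod_measure a_def b_def)
    then show ?thesis using False by simp
  qed
  have "0 \<le> g W" for W using w0 by (simp add: g_def sum_nonneg)
  moreover have "g (V \<union> W) = g V + g W"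
    if "V \<in> sets borel" "W \<in> sets borel" "V \<inter> W = {}" for V W
  proof -
    have "w s t (V \<union> W) = w s t V + w s t W" for s t
    proof -
      have "measure (\<mu> \<Otimes>\<^sub>M \<nu>) ((V \<inter> cc s \<times> dd t) \<union> (W \<inter> cc s \<times> dd t)) =
        measure (\<mu> \<Otimes>\<^sub>M \<nu>) (V \<inter> cc s \<times> dd t) + measure (\<mu> \<Otimes>\<^sub>M \<nu>) (W \<inter> cc s \<times> dd t)"
      proof (rule P.finite_measure_Union)
        show "V \<inter> cc s \<times> dd t \<in> sets (\<mu> \<Otimes>\<^sub>M \<nu>)" "W \<inter> cc s \<times> dd t \<in> sets (\<mu> \<Otimes>\<^sub>M \<nu>)"
          unfolding sets_pair using that borel_Times[OF cc dd] by blast+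
      qed (use that in blast)
      then show ?thesis by (simp add: w_def Int_Un_distrib2 distrib_left)
    qed
    then show ?thesis by (simp add: g_def sum.distrib)
  qed
  moreover have "g (A \<times> UNIV) = measure \<mu> A" if A: "A \<in> sets borel" for A
  proof -
    have "w s t (A \<times> UNIV) = q s t * (measure \<mu> (A \<inter> cc s) / a s)" if "s \<in> I" "t \<in> J" for s t
    proof -
      have "measure (\<mu> \<Otimes>\<^sub>M \<nu>) (A \<times> UNIV \<inter> cc s \<times> dd t) = measure \<mu> (A \<inter> cc s) * b t"
        using prod_measure[of "A \<inter> cc s" "dd t"] A by (simp add: Times_Int_Times b_def)
      then show ?thesis using qb0[OF _ that] by (cases "b t = 0") (auto simp: w_def)
    qed
    then have "g (A \<times> UNIV) = (\<Sum>s\<in>I. (\<Sum>t\<in>J. q s t) * (measure \<mu> (A \<inter> cc s) / a s))"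
      by (simp add: g_def sum_distrib_right sum_divide_distrib)
    also have "\<dots> = (\<Sum>s\<in>I. measure \<mu> (A \<inter> cc s))"
    proof (rule sum.cong)
      fix s assume "s \<in> I"
      have "measure \<mu> (A \<inter> cc s) \<le> a s"
        unfolding a_def by (intro \<mu>.finite_measure_mono) auto
      then have z: "measure \<mu> (A \<inter> cc s) = 0" if "a s = 0"
        using that measure_nonneg[of \<mu> "A \<inter> cc s"] by linarith
      show "(\<Sum>t\<in>J. q s t) * (measure \<mu> (A \<inter> cc s) / a s) = measure \<mu> (A \<inter> cc s)"
        using qa[OF \<open>s \<in> I\<close>] z by (cases "a s = 0") auto
    qed simp
    also have "\<dots> = measure \<mu> A" using split_\<mu>[OF fin(1) A] cI by simp
    finally show ?thesis .
  qed
  moreover have "g (UNIV \<times> B) = measure \<nu> B" if B: "B \<in> sets borel" for B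
  proof -
    have "w s t (UNIV \<times> B) = q s t * (measure \<nu> (B \<inter> dd t) / b t)" if "s \<in> I" "t \<in> J" for s t
    proof -
      have "measure (\<mu> \<Otimes>\<^sub>M \<nu>) (UNIV \<times> B \<inter> cc s \<times> dd t) = a s * measure \<nu> (B \<inter> dd t)"
        using prod_measure[of "cc s" "B \<inter> dd t"] B by (simp add: Times_Int_Times a_def)
      then show ?thesis using qa0[OF _ that] by (cases "a s = 0") (auto simp: w_def)
    qed
    then have "g (UNIV \<times> B) = (\<Sum>t\<in>J. (\<Sum>s\<in>I. q s t) * (measure \<nu> (B \<inter> dd t) / b t))"
      unfolding g_def by (subst sum.swap) (simp add: sum_distrib_right sum_divide_distrib)
    also have "\<dots> = (\<Sum>t\<in>J. measure \<nu> (B \<inter> dd t))"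
    proof (rule sum.cong)
      fix t assume "t \<in> J"
      have "measure \<nu> (B \<inter> dd t) \<le> b t"
        unfolding b_def by (intro \<nu>.finite_measure_mono) auto
      then have z: "measure \<nu> (B \<inter> dd t) = 0" if "b t = 0"
        using that measure_nonneg[of \<nu> "B \<inter> dd t"] by linarith
      show "(\<Sum>s\<in>I. q s t) * (measure \<nu> (B \<inter> dd t) / b t) = measure \<nu> (B \<inter> dd t)"
        using qb[OF \<open>t \<in> J\<close>] z by (cases "b t = 0") auto
    qed simp
    also have "\<dots> = measure \<nu> B" using split_\<nu>[OF fin(2) B] dJ by simp
    finally show ?thesis .
  qed
  moreover have "g W \<le> 1 - cap K"
    if W: "W \<in> sets borel" "map_prod c d ` W \<inter> map_prod c d ` K = {}" for W
  proof -
    \<comment> \<open>\<open>W\<close> avoids every pair of cells that meets \<open>K\<close>, so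
      its mass comes from the pairs outside \<open>R\<close>, which carry at most
      \<open>1 - cap K\<close> in total.\<close>
    have w_R: "w s t W = 0" if "R s t" for s t
    proof -
      have "W \<inter> cc s \<times> dd t = {}"
      proof (rule ccontr)
        assume "W \<inter> cc s \<times> dd t \<noteq> {}"
        then obtain x y where xy: "(x, y) \<in> W" "c x = s" "d y = t" by (auto simp: cc_def dd_def)
        from xy(1) have "map_prod c d (x, y) \<in> map_prod c d ` W" by (intro imageI)
        then have "(s, t) \<in> map_prod c d ` W" by (simp only: map_prod_simp xy(2,3))
        then have "(s, t) \<in> map_prod c d ` W \<inter> map_prod c d ` K"
          using that unfolding R_def by (rule IntI)
        then show False unfolding W(2) by (rule emptyE)
      qed
      then show ?thesis by (simp add: w_def)
    qed
    have split: "(\<Sum>t\<in>J. f t) = (\<Sum>t\<in>{t\<in>J. R s t}. f t) + (\<Sum>t\<in>{t\<in>J. \<not> R s t}. f t)"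
      for f :: "'j \<Rightarrow> real" and s
      using fin(2) by (subst sum.union_disjoint[symmetric]) (auto intro!: sum.cong)
    have "g W = (\<Sum>s\<in>I. \<Sum>t\<in>{t\<in>J. \<not> R s t}. w s t W)"
      unfolding g_def
    proof (rule sum.cong[OF refl])
      show "(\<Sum>t\<in>J. w s t W) = (\<Sum>t\<in>{t\<in>J. \<not> R s t}. w s t W)" for s
        by (subst split[of _ s]) (simp add: w_R)
    qed
    also have "\<dots> \<le> (\<Sum>s\<in>I. \<Sum>t\<in>{t\<in>J. \<not> R s t}. q s t)"
      using W(1) by (intro sum_mono w_le) auto
    also have "\<dots> = (\<Sum>s\<in>I. (\<Sum>t\<in>J. q s t) - (\<Sum>t\<in>{t\<in>J. R s t}. q s t))"
    proof (rule sum.cong[OF refl])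
      show "(\<Sum>t\<in>{t\<in>J. \<not> R s t}. q s t) = (\<Sum>t\<in>J. q s t) - (\<Sum>t\<in>{t\<in>J. R s t}. q s t)" for s
        by (subst split[of _ s]) simp
    qed
    also have "\<dots> = sum a I - (\<Sum>s\<in>I. \<Sum>t\<in>{t\<in>J. R s t}. q s t)"
      by (simp add: sum_subtractf qa)
    also have "\<dots> \<le> 1 - cap K" using qR tot_a by simp
    finally show ?thesis .
  qed
  ultimately show ?thesis by (intro exI[of _ g]) blast
qed

end

lemma countable_open_basis:
  "\<exists>U :: nat \<Rightarrow> 'a::second_countable_topology set.
     (\<forall>n. open (U n)) \<and> (\<forall>S x. open S \<longrightarrow> x \<in> S \<longrightarrow> (\<exists>n. x \<in> U n \<and> U n \<subseteq> S))"
proof -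
  obtain B :: "'a set set" where B: "countable B" "topological_basis B"
    using ex_countable_basis by blast
  \<comment> \<open>Inserting \<open>UNIV\<close> makes the family nonempty, as an enumeration by
    \<open>from_nat_into\<close> requires.\<close>
  define U where "U = from_nat_into (insert UNIV B)"
  have rU: "range U = insert UNIV B" unfolding U_def using B(1) by (intro range_from_nat_into) auto
  have "open (U n)" for n
  proof -
    have "U n \<in> insert UNIV B" using rU by blast
    then show ?thesis using topological_basis_open[OF B(2)] by auto
  qed
  moreover have "\<exists>n. x \<in> U n \<and> U n \<subseteq> S" if S: "open S" "x \<in> S" for S x
  proof -
    obtain B' where B': "B' \<in> B" "x \<in> B'" "B' \<subseteq> S" by (rule topological_basisE[OF B(2) S])
    then have "B' \<in> range U" using rU by blast
    then show ?thesis using B' by blast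
  qed
  ultimately show ?thesis by (intro exI[of _ U]) blast
qed

section \<open>Limits of discrete couplings\<close>

context marginals
begin

definition coupling :: "('a \<times> 'b) measure \<Rightarrow> bool" where
  "coupling P \<longleftrightarrow> prob_space P \<and> sets P = sets borel \<and>
     (\<forall>A\<in>sets borel. measure P (A \<times> UNIV) = measure \<mu> A) \<and>
     (\<forall>B\<in>sets borel. measure P (UNIV \<times> B) = measure \<nu> B)"

text \<open>The complement of \<open>K\<close> is an increasing union of sets \<open>W m\<close>,
  each a finite union of basic rectangles. Couplings adapted to ever finer partitions eventually
  give every \<open>W m\<close> mass at most \<open>1 - cap K\<close>. This bound passes to a
  cluster point and from there to the measure built by \<open>coupling_of_content\<close>.\<close>

lemma compact_coupling:
  assumes K: "compact K"
  obtains P where "coupling P" "cap K \<le> measure P K"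
proof -
  obtain U :: "nat \<Rightarrow> 'a set" where "\<forall>n. open (U n)"
    "\<forall>S x. open S \<longrightarrow> x \<in> S \<longrightarrow> (\<exists>n. x \<in> U n \<and> U n \<subseteq> S)"
    using countable_open_basis[where 'a='a] by (elim exE conjE)
  then have U: "\<And>n. open (U n)"
    "\<And>S x. open S \<Longrightarrow> x \<in> S \<Longrightarrow> \<exists>n. x \<in> U n \<and> U n \<subseteq> S" by auto
  obtain V :: "nat \<Rightarrow> 'b set" where "\<forall>n. open (V n)"
    "\<forall>S x. open S \<longrightarrow> x \<in> S \<longrightarrow> (\<exists>n. x \<in> V n \<and> V n \<subseteq> S)"
    using countable_open_basis[where 'a='b] by (elim exE conjE)
  then have V: "\<And>n. open (V n)"
    "\<And>S x. open S \<Longrightarrow> x \<in> S \<Longrightarrow> \<exists>n. x \<in> V n \<and> V n \<subseteq> S" by auto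
  have UV [measurable]: "U n \<in> sets borel" "V n \<in> sets borel" for n using U(1) V(1) by auto
  define W where "W m = \<Union>{U i \<times> V j | i j. i < m \<and> j < m \<and> U i \<times> V j \<inter> K = {}}" for m :: nat
  have fin_rect: "finite {U i \<times> V j | i j. i < m \<and> j < m \<and> U i \<times> V j \<inter> K = {}}" for m
    by (rule finite_subset[of _ "(\<lambda>(i, j). U i \<times> V j) ` ({..<m} \<times> {..<m})"]) auto
  have W_open: "open (W m)" for m unfolding W_def using U(1) V(1) by (auto intro!: open_Times)
  have W_borel [measurable]: "W m \<in> sets borel" for m using W_open by auto
  \<comment> \<open>The code of a point records which of the first \<open>n\<close> basic sets
    contain it. So a pair with the same codes as a point of \<open>K\<close> lies in no rectangle of
    \<open>W m\<close> for \<open>m \<le> n\<close>.\<close>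
  define c where "c n x = {i. i < n \<and> x \<in> U i}" for n x
  define d where "d n y = {j. j < n \<and> y \<in> V j}" for n y
  have meas: "c n \<in> borel \<rightarrow>\<^sub>M count_space (Pow {..<n})" "d n \<in> borel \<rightarrow>\<^sub>M count_space (Pow {..<n})" for n
  proof -
    have "{x. c n x = s} \<in> sets borel" "{y. d n y = s} \<in> sets borel" for s
    proof -
      have "{x. c n x = s} = (\<Inter>i. {x. (i < n \<and> x \<in> U i) = (i \<in> s)})" by (auto simp: c_def)
      then show "{x. c n x = s} \<in> sets borel" by simp
      have "{y. d n y = s} = (\<Inter>i. {y. (i < n \<and> y \<in> V i) = (i \<in> s)})" by (auto simp: d_def)
      then show "{y. d n y = s} \<in> sets borel" by simp
    qed
    then show "c n \<in> borel \<rightarrow>\<^sub>M count_space (Pow {..<n})" "d n \<in> borel \<rightarrow>\<^sub>M count_space (Pow {..<n})"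
      by (auto simp: measurable_count_space_eq2 c_def d_def vimage_def)
  qed
  define good where "good n g \<longleftrightarrow> (\<forall>W\<in>sets borel. 0 \<le> g W) \<and>
    (\<forall>V\<in>sets borel. \<forall>W\<in>sets borel. V \<inter> W = {} \<longrightarrow> g (V \<union> W) = g V + g W) \<and>
    (\<forall>A\<in>sets borel. g (A \<times> UNIV) = measure \<mu> A) \<and> (\<forall>B\<in>sets borel. g (UNIV \<times> B) = measure \<nu> B) \<and>
    (\<forall>W\<in>sets borel. map_prod (c n) (d n) ` W \<inter> map_prod (c n) (d n) ` K = {} \<longrightarrow> g W \<le> 1 - cap K)"
    for n and g :: "('a \<times> 'b) set \<Rightarrow> real"
  have "\<forall>n. \<exists>g. good n g"
    unfolding good_def using discrete_coupling[OF meas] by simp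
  from choice[OF this] obtain g where g: "\<And>n. good n (g n)" by blast
  have g_add: "g n (V \<union> W) = g n V + g n W" if "V \<in> sets borel" "W \<in> sets borel" "V \<inter> W = {}" for n V W
    using g[of n] that unfolding good_def by (elim conjE) (drule (1) bspec, drule (1) bspec, drule (1) mp)
  have g_fst: "g n (A \<times> UNIV) = measure \<mu> A" if "A \<in> sets borel" for n A
    using g[of n] that by (simp add: good_def)
  have g_W: "g n (W m) \<le> 1 - cap K" if "m \<le> n" for n m
  proof -
    have "map_prod (c n) (d n) ` W m \<inter> map_prod (c n) (d n) ` K = {}"
    proof (rule ccontr)
      assume "\<not> ?thesis"
      then obtain x y x' y' where xy: "(x, y) \<in> W m" "(x', y') \<in> K" "c n x = c n x'" "d n y = d n y'"
        by (auto simp: map_prod_def)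
      then obtain i j where ij: "i < m" "j < m" "U i \<times> V j \<inter> K = {}" "x \<in> U i" "y \<in> V j"
        unfolding W_def by blast
      then have "i \<in> c n x" "j \<in> d n y" using that by (auto simp: c_def d_def)
      then have "i \<in> c n x'" "j \<in> d n y'" using xy by simp_all
      then have "(x', y') \<in> U i \<times> V j \<inter> K" using xy(2) by (auto simp: c_def d_def)
      then show False using ij(3) by blast
    qed
    then show ?thesis using g[of n] W_borel[of m] by (simp add: good_def)
  qed
  have g_mono: "g n A \<le> 1" if "A \<in> sets borel" for n A
  proof -
    have "g n (A \<union> - A) = g n A + g n (- A)"
      by (rule g_add) (use that borel_comp[OF that] in auto)
    moreover have "g n UNIV = 1"
      using g_fst[of UNIV n] \<mu>.prob_space by simp
    moreover have "0 \<le> g n (- A)" using g[of n] borel_comp[OF that] by (simp add: good_def)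
    ultimately show ?thesis by (simp add: Compl_partition)
  qed
  \<comment> \<open>Nothing is known about \<open>g n\<close> on non-Borel sets; the value 0 there
    places all \<open>h n\<close> in a product of unit intervals, which is compact by Tychonoff's
    theorem.\<close>
  define h where "h n A = (if A \<in> sets borel then g n A else 0)" for n A
  have h_in: "h n \<in> PiE UNIV (\<lambda>_. {0..1})" for n
    using g_mono g[of n] by (auto simp: h_def good_def)
  have "compactin (product_topology (\<lambda>_. euclidean) UNIV) (PiE (UNIV :: ('a \<times> 'b) set set) (\<lambda>_. {0..1::real}))"
    unfolding compactin_PiE by auto
  then have "compact (PiE (UNIV :: ('a \<times> 'b) set set) (\<lambda>_. {0..1::real}))"
    by (simp add: euclidean_product_topology)
  then obtain l where l_in: "l \<in> PiE UNIV (\<lambda>_. {0..1})"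
    and l: "\<And>S. closed S \<Longrightarrow> eventually (\<lambda>n. h n \<in> S) sequentially \<Longrightarrow> l \<in> S"
    by (rule cluster_point[of _ h]) (use h_in in blast)+
  have co: "continuous_on UNIV (\<lambda>f :: ('a \<times> 'b) set \<Rightarrow> real. f A)" for A
    by (rule continuous_on_product_coordinates)
  have l_eq: "l A = r" if "\<And>n. h n A = r" for A r
  proof -
    have "l \<in> {f. f A = r}"
    proof (rule l)
      show "closed {f :: ('a \<times> 'b) set \<Rightarrow> real. f A = r}"
        by (intro closed_Collect_eq co continuous_on_const)
    qed (simp add: that)
    then show ?thesis by simp
  qed
  have l_add: "l (V \<union> W) = l V + l W" if "V \<in> sets borel" "W \<in> sets borel" "V \<inter> W = {}" for V W
  proof -
    have "l \<in> {f. f (V \<union> W) = f V + f W}"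
    proof (rule l)
      show "eventually (\<lambda>n. h n \<in> {f. f (V \<union> W) = f V + f W}) sequentially"
        using g_add[OF that] that by (simp add: h_def)
    qed (intro closed_Collect_eq co continuous_on_add)
    then show ?thesis by simp
  qed
  have l_W: "l (W m) \<le> 1 - cap K" for m
  proof -
    have "l \<in> {f. f (W m) \<le> 1 - cap K}"
    proof (rule l)
      show "eventually (\<lambda>n. h n \<in> {f. f (W m) \<le> 1 - cap K}) sequentially"
        by (rule eventually_mono[OF eventually_ge_at_top[of m]]) (use g_W W_borel in \<open>simp add: h_def\<close>)
    qed (intro closed_Collect_le co continuous_on_const)
    then show ?thesis by simp
  qed
  have l_fst: "l (A \<times> UNIV) = measure \<mu> A" if "A \<in> sets borel" for A
    by (rule l_eq) (use g that borel_Times[OF that, of "UNIV :: 'b set"] in \<open>simp add: h_def good_def\<close>)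
  have l_snd: "l (UNIV \<times> B) = measure \<nu> B" if "B \<in> sets borel" for B
    by (rule l_eq) (use g that borel_Times[OF _ that, of "UNIV :: 'a set"] in \<open>simp add: h_def good_def\<close>)
  have l_pos: "0 \<le> l A" for A using l_in by (auto simp: PiE_iff)
  obtain P where P: "prob_space P" "sets P = sets borel"
    "\<forall>\<R>. finite \<R> \<longrightarrow> \<R> \<subseteq> {A \<times> B | A B. A \<in> sets borel \<and> B \<in> sets borel} \<longrightarrow> measure P (\<Union>\<R>) = l (\<Union>\<R>)"
    by (rule coupling_of_content[OF l_pos l_add l_fst l_snd])
  note P_Union = P(3)[rule_format]
  have P_rect: "measure P (A \<times> B) = l (A \<times> B)" if "A \<in> sets borel" "B \<in> sets borel" for A B
    using P_Union[of "{A \<times> B}"] that by auto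
  have "coupling P"
    unfolding coupling_def using P(1,2) P_rect l_fst l_snd by simp
  moreover have "cap K \<le> measure P K"
  proof -
    interpret P: prob_space P by fact
    \<comment> \<open>The sets \<open>W m\<close> were built as finite unions of rectangles because
      agreement of \<open>P\<close> with \<open>l\<close> is known for such unions.\<close>
    have P_W: "measure P (W m) \<le> 1 - cap K" for m
    proof -
      have "{U i \<times> V j | i j. i < m \<and> j < m \<and> U i \<times> V j \<inter> K = {}} \<subseteq>
        {A \<times> B | A B. A \<in> sets borel \<and> B \<in> sets borel}"
      proof
        fix Z assume "Z \<in> {U i \<times> V j | i j. i < m \<and> j < m \<and> U i \<times> V j \<inter> K = {}}"
        then obtain i j where "Z = U i \<times> V j" by (elim CollectE exE conjE)
        then show "Z \<in> {A \<times> B | A B. A \<in> sets borel \<and> B \<in> sets borel}" using UV by blast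
      qed
      from P_Union[OF fin_rect this] l_W[of m] show ?thesis by (simp add: W_def)
    qed
    have "(\<lambda>m. measure P (W m)) \<longlonglongrightarrow> measure P (\<Union>m. W m)"
    proof (rule P.finite_Lim_measure_incseq)
      show "range W \<subseteq> sets P" unfolding P(2) by (rule image_subsetI) (rule W_borel)
      show "incseq W"
      proof (rule incseq_SucI)
        fix m
        have "{U i \<times> V j | i j. i < m \<and> j < m \<and> U i \<times> V j \<inter> K = {}} \<subseteq>
          {U i \<times> V j | i j. i < Suc m \<and> j < Suc m \<and> U i \<times> V j \<inter> K = {}}"
          by (intro Collect_mono ex_mono impI) auto
        then show "W m \<subseteq> W (Suc m)" unfolding W_def by (rule Union_mono)
      qed
    qed
    then have "measure P (\<Union>m. W m) \<le> 1 - cap K" by (rule LIMSEQ_le_const2) (use P_W in blast)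
    moreover have "(\<Union>m. W m) = - K"
    proof
      have "W m \<subseteq> - K" for m
        unfolding W_def by (rule Union_least, elim CollectE exE conjE) blast
      then show "(\<Union>m. W m) \<subseteq> - K" by blast
      show "- K \<subseteq> (\<Union>m. W m)"
      proof
        fix p assume "p \<in> - K"
        have "open (- K)" using K by (intro open_Compl compact_imp_closed)
        then obtain A B where AB: "open A" "open B" "p \<in> A \<times> B" "A \<times> B \<subseteq> - K"
          using \<open>p \<in> - K\<close> by (rule open_prod_elim)
        obtain i where i: "fst p \<in> U i" "U i \<subseteq> A" using U(2)[OF AB(1), of "fst p"] AB(3) by auto
        obtain j where j: "snd p \<in> V j" "V j \<subseteq> B" using V(2)[OF AB(2), of "snd p"] AB(3) by auto
        have "U i \<times> V j \<inter> K = {}" using i(2) j(2) AB(4) by blast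
        then have "U i \<times> V j \<subseteq> W (Suc (max i j))" unfolding W_def
          using \<open>U i \<times> V j \<inter> K = {}\<close>
          by (intro Union_upper CollectI exI[of _ i] exI[of _ j] conjI refl) simp_all
        then show "p \<in> (\<Union>m. W m)" using i(1) j(1) by (cases p) auto
      qed
    qed
    moreover have "measure P (- K) = 1 - measure P K"
      using P.prob_compl[of K] sets_eq_imp_space_eq[OF P(2)] P(2) K
      by (simp add: Compl_eq_Diff_UNIV borel_closed compact_imp_closed)
    ultimately show ?thesis by simp
  qed
  ultimately show ?thesis by (rule that)
qed

end

section \<open>Separation by an invariant set\<close>

lemma sigma_compact_inner:
  fixes M :: "'a::polish_space measure"
  assumes M: "prob_space M" "sets M = sets borel" and A: "A \<in> sets borel"
  obtains L :: "nat \<Rightarrow> 'a set"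
  where "\<And>n. compact (L n)" "(\<Union>n. L n) \<subseteq> A" "measure M (\<Union>n. L n) = measure M A"
proof -
  interpret prob_space M by fact
  have "\<forall>n. \<exists>K. compact K \<and> K \<subseteq> A \<and> measure M A - 1 / real (Suc n) < measure M K"
    by (intro allI compact_inner[OF M A]) simp
  from choice[OF this] obtain L where L: "\<And>n. compact (L n)" "\<And>n. L n \<subseteq> A"
    "\<And>n. measure M A - 1 / real (Suc n) < measure M (L n)" by auto
  have sL: "(\<Union>n. L n) \<subseteq> A" using L(2) by blast
  have LM: "L n \<in> sets M" for n unfolding M(2) by (intro borel_closed compact_imp_closed L)
  have UM: "(\<Union>n. L n) \<in> sets M" using LM by blast
  have "measure M (\<Union>n. L n) \<le> measure M A"
    using sL A M(2) by (intro finite_measure_mono) auto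
  moreover have "measure M A \<le> measure M (\<Union>n. L n)"
  proof (rule LIMSEQ_le_const2)
    show "(\<lambda>n. measure M A - 1 / real (Suc n)) \<longlonglongrightarrow> measure M A"
      using tendsto_diff[OF tendsto_const LIMSEQ_inverse_real_of_nat, of "measure M A"]
      by (simp add: inverse_eq_divide)
    have "measure M A - 1 / real (Suc n) \<le> measure M (\<Union>n. L n)" for n
    proof -
      have "measure M (L n) \<le> measure M (\<Union>n. L n)" by (rule finite_measure_mono[OF _ UM]) blast
      then show ?thesis using L(3)[of n] by linarith
    qed
    then show "\<exists>N. \<forall>n\<ge>N. measure M A - 1 / real (Suc n) \<le> measure M (\<Union>n. L n)" by blast
  qed
  ultimately show ?thesis using that[OF L(1) sL] by simp
qed

context marginals
begin

text \<open>Three reductions are combined: an optimal cover, a compact subset with almost the same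
  capacity, and a coupling for that subset. The compact sets stay in the conclusion because their
  projections are Borel, whereas projections of \<open>E\<close> need not be.\<close>

lemma cap_duality:
  assumes E: "E \<in> sets borel"
  shows "\<exists>X Y P K. covers X Y E \<and> measure \<mu> X + measure \<nu> Y = cap E \<and>
    (\<forall>n::nat. coupling (P n) \<and> compact (K n) \<and> K n \<subseteq> E \<and> cap E - 1 / real (Suc n) \<le> measure (P n) (K n))"
proof -
  obtain X Y where XY: "covers X Y E" "measure \<mu> X + measure \<nu> Y = cap E" by (rule cap_attained)
  have "\<exists>P K. coupling P \<and> compact K \<and> K \<subseteq> E \<and> cap E - 1 / real (Suc n) \<le> measure P K" for n
  proof -
    obtain K where K: "compact K" "K \<subseteq> E" "cap E - 1 / real (Suc n) \<le> cap K"
      by (rule cap_compact[OF E, of "1 / real (Suc n)"]) auto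
    obtain P where "coupling P" "cap K \<le> measure P K" by (rule compact_coupling[OF K(1)])
    then show ?thesis using K by (intro exI[of _ P] exI[of _ K]) simp
  qed
  then have "\<forall>n. \<exists>z. coupling (fst z) \<and> compact (snd z) \<and> snd z \<subseteq> E \<and>
      cap E - 1 / real (Suc n) \<le> measure (fst z) (snd z)" by simp
  from choice[OF this] obtain z where "\<forall>n. coupling (fst (z n)) \<and> compact (snd (z n)) \<and> snd (z n) \<subseteq> E \<and>
      cap E - 1 / real (Suc n) \<le> measure (fst (z n)) (snd (z n))" ..
  with XY show ?thesis by (intro exI[of _ X] exI[of _ Y] exI[of _ "\<lambda>n. fst (z n)"] exI[of _ "\<lambda>n. snd (z n)"] conjI) auto
qed

text \<open>A pair in \<open>K\<close> starts outside \<open>A\<close> or ends in \<open>S\<close>,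
  so two marginal terms bound its mass. With \<open>A\<close> of full mass in the complement of an
  optimal \<open>X\<close>, this forces \<open>S\<close> to be as large as \<open>Y\<close>, which
  is complementary slackness.\<close>

lemma coupling_le_fst:
  assumes "coupling P" "K \<in> sets borel" "A \<in> sets borel" "S \<in> sets borel" "K \<inter> A \<times> UNIV \<subseteq> UNIV \<times> S"
  shows "measure P K \<le> measure \<mu> (- A) + measure \<nu> S"
proof -
  interpret P: prob_space P using assms(1) by (simp add: coupling_def)
  have sP: "sets P = sets borel" using assms(1) by (simp add: coupling_def)
  have Times: "A \<times> B \<in> sets P" if "A \<in> sets borel" "B \<in> sets borel"
    for A :: "'a set" and B :: "'b set"
    unfolding sP by (rule borel_Times[OF that])
  have "measure P K \<le> measure P ((- A) \<times> UNIV \<union> UNIV \<times> S)"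
  proof (rule P.finite_measure_mono)
    show "K \<subseteq> (- A) \<times> UNIV \<union> UNIV \<times> S" using assms(5) by auto
    show "(- A) \<times> UNIV \<union> UNIV \<times> S \<in> sets P" by (intro sets.Un Times borel_comp assms) auto
  qed
  also have "\<dots> \<le> measure P ((- A) \<times> UNIV) + measure P (UNIV \<times> S)"
    by (intro measure_Un_le Times borel_comp assms) auto
  also have "\<dots> = measure \<mu> (- A) + measure \<nu> S"
    using assms(1,4) borel_comp[OF assms(3)] by (simp add: coupling_def)
  finally show ?thesis .
qed

lemma coupling_le_snd:
  assumes "coupling P" "K \<in> sets borel" "B \<in> sets borel" "T \<in> sets borel" "K \<inter> UNIV \<times> B \<subseteq> T \<times> UNIV"
  shows "measure P K \<le> measure \<mu> T + measure \<nu> (- B)"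
proof -
  have "K \<inter> (- T) \<times> UNIV \<subseteq> UNIV \<times> (- B)" using assms(5) by auto
  from coupling_le_fst[OF assms(1,2) borel_comp[OF assms(4)] borel_comp[OF assms(3)] this]
  show ?thesis by simp
qed

end

text \<open>The couplings \<open>P n\<close> show that the infimum is at most
  \<open>measure \<mu> A - measure \<nu> A\<close>. No absolute value is taken because
  \<open>A\<close> is built from the complement of \<open>X\<close>, which makes this difference at
  least \<open>1 - cap E \<ge> 0\<close>.\<close>

lemma invariant_separation_polish:
  fixes \<mu> \<nu> :: "'a::polish_space measure"
  assumes "marginals \<mu> \<nu>" and E: "E \<in> sets borel" "equiv UNIV E"
  shows "\<exists>A B P. A \<in> sets borel \<and> B \<in> sets borel \<and> measure \<mu> B = 1 \<and> measure \<nu> B = 1 \<and>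
    (\<forall>(x, y)\<in>E \<inter> B \<times> B. x \<in> A \<longleftrightarrow> y \<in> A) \<and>
    (\<forall>n::nat. marginals.coupling \<mu> \<nu> (P n) \<and> 1 - measure (P n) E \<le> measure \<mu> A - measure \<nu> A + 1 / real (Suc n))"
proof -
  interpret marginals \<mu> \<nu> by fact
  obtain X Y P K where XY: "covers X Y E" "measure \<mu> X + measure \<nu> Y = cap E"
    and PK: "\<forall>n::nat. coupling (P n) \<and> compact (K n) \<and> K n \<subseteq> E \<and> cap E - 1 / real (Suc n) \<le> measure (P n) (K n)"
    using cap_duality[OF E(1)] by (elim exE conjE)
  have P: "\<And>n. coupling (P n)" and K: "\<And>n. compact (K n)" "\<And>n. K n \<subseteq> E"
    and PK: "\<And>n. cap E - 1 / real (Suc n) \<le> measure (P n) (K n)"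
    using PK by auto
  have [simp]: "X \<in> sets borel" "Y \<in> sets borel" using XY(1) by (auto simp: covers_def)
  have E_XY: "x \<in> X \<or> y \<in> Y" if "(x, y) \<in> E" for x y using XY(1) that by (auto simp: covers_def)
  have E_sym: "(y, x) \<in> E" if "(x, y) \<in> E" for x y
    using E(2) that by (auto simp: equiv_def elim: symE)
  have E_trans: "(x, z) \<in> E" if "(x, y) \<in> E" "(y, z) \<in> E" for x y z
    using E(2) that unfolding equiv_def by (blast elim: transE)
  have E_refl: "(x, x) \<in> E" for x using E(2) by (auto simp: equiv_def refl_on_def)
  obtain L :: "nat \<Rightarrow> 'a set" where L: "\<And>n. compact (L n)" "(\<Union>n. L n) \<subseteq> - X"
    "measure \<mu> (\<Union>n. L n) = measure \<mu> (- X)"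
    by (rule sigma_compact_inner[of \<mu> "- X"]) (auto simp: \<mu>.prob_space_axioms borel_comp)
  obtain L' :: "nat \<Rightarrow> 'a set" where L': "\<And>n. compact (L' n)" "(\<Union>n. L' n) \<subseteq> - Y"
    "measure \<nu> (\<Union>n. L' n) = measure \<nu> (- Y)"
    by (rule sigma_compact_inner[of \<nu> "- Y"]) (auto simp: \<nu>.prob_space_axioms borel_comp)
  define A0 where "A0 = (\<Union>n. L n)"
  define D0 where "D0 = (\<Union>n. L' n)"
  \<comment> \<open>The union over \<open>n\<close> lets one set serve all \<open>K n\<close>; the
    union over the compact pieces \<open>L m\<close> makes every projection compact and hence
    Borel.\<close>
  define S where "S = (\<Union>n. \<Union>m. snd ` (K n \<inter> L m \<times> UNIV))"
  define T where "T = (\<Union>n. \<Union>m. fst ` (K n \<inter> UNIV \<times> L' m))"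
  have cb: "compact C \<Longrightarrow> C \<in> sets borel" for C :: "'a set" by (intro borel_closed compact_imp_closed)
  have K_borel: "K n \<in> sets borel" for n by (intro borel_closed compact_imp_closed K)
  have A0 [simp]: "A0 \<in> sets borel" unfolding A0_def using cb[OF L(1)] by blast
  have D0 [simp]: "D0 \<in> sets borel" unfolding D0_def using cb[OF L'(1)] by blast
  have "snd ` (K n \<inter> L m \<times> UNIV) \<in> sets borel" for n m
    by (intro cb compact_continuous_image[OF continuous_on_snd[OF continuous_on_id]]
      compact_Int_closed K closed_Times compact_imp_closed[OF L(1)] closed_UNIV)
  then have S [simp]: "S \<in> sets borel" unfolding S_def by blast
  have "fst ` (K n \<inter> UNIV \<times> L' m) \<in> sets borel" for n m
    by (intro cb compact_continuous_image[OF continuous_on_fst[OF continuous_on_id]]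
      compact_Int_closed K closed_Times compact_imp_closed[OF L'(1)] closed_UNIV)
  then have T [simp]: "T \<in> sets borel" unfolding T_def by blast
  have not_rel: "(x, y) \<notin> E" if "x \<in> A0" "y \<in> D0" for x y
    using E_XY[of x y] that L(2) L'(2) by (auto simp: A0_def D0_def)
  have S_rel: "\<exists>x\<in>A0. (x, y) \<in> E" if y: "y \<in> S" for y
  proof -
    obtain n m where "y \<in> snd ` (K n \<inter> L m \<times> UNIV)" using y unfolding S_def by blast
    then obtain p where "y = snd p" "p \<in> K n \<inter> L m \<times> UNIV" by (rule imageE)
    then have "fst p \<in> A0" "(fst p, y) \<in> E" using K(2)[of n] by (auto simp: A0_def mem_Times_iff)
    then show ?thesis by blast
  qed
  have T_rel: "\<exists>y\<in>D0. (x, y) \<in> E" if x: "x \<in> T" for x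
  proof -
    obtain n m where "x \<in> fst ` (K n \<inter> UNIV \<times> L' m)" using x unfolding T_def by blast
    then obtain p where "x = fst p" "p \<in> K n \<inter> UNIV \<times> L' m" by (rule imageE)
    then have "snd p \<in> D0" "(x, snd p) \<in> E" using K(2)[of n] by (auto simp: D0_def mem_Times_iff)
    then show ?thesis by blast
  qed
  have meas_A0: "measure \<mu> A0 = 1 - measure \<mu> X"
    using L(3) \<mu>.prob_compl[of X] by (simp add: A0_def Compl_eq_Diff_UNIV)
  have meas_D0: "measure \<nu> D0 = 1 - measure \<nu> Y"
    using L'(3) \<nu>.prob_compl[of Y] by (simp add: D0_def Compl_eq_Diff_UNIV)
  have comp: "measure \<mu> (- A0) = measure \<mu> X" "measure \<nu> (- D0) = measure \<nu> Y"
    unfolding Compl_eq_Diff_UNIV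
    using \<mu>.prob_compl[of A0] \<nu>.prob_compl[of D0] meas_A0 meas_D0 by simp_all
  have lim: "cap E \<le> r" if "\<And>n. measure (P n) (K n) \<le> r" for r
  proof (rule LIMSEQ_le_const2)
    show "(\<lambda>n. cap E - 1 / real (Suc n)) \<longlonglongrightarrow> cap E"
      using tendsto_diff[OF tendsto_const LIMSEQ_inverse_real_of_nat, of "cap E"]
      by (simp add: inverse_eq_divide)
    show "\<exists>N. \<forall>n\<ge>N. cap E - 1 / real (Suc n) \<le> r" using PK that by (meson order_trans)
  qed
  \<comment> \<open>Each \<open>K n\<close> sends \<open>A0\<close> into \<open>S\<close>, so the
    bound holds for every \<open>n\<close> and survives the limit. Cancelling
    \<open>measure \<mu> X\<close> on both sides shows that \<open>S\<close> has at least the mass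
    of \<open>Y\<close>. The argument for \<open>T\<close> is symmetric.\<close>
  have "cap E \<le> measure \<mu> (- A0) + measure \<nu> S"
  proof (rule lim, rule coupling_le_fst)
    show "K n \<inter> A0 \<times> UNIV \<subseteq> UNIV \<times> S" for n
    proof
      fix p assume "p \<in> K n \<inter> A0 \<times> UNIV"
      then obtain m where "p \<in> K n \<inter> L m \<times> UNIV" by (auto simp: A0_def)
      then have "snd p \<in> S" unfolding S_def by blast
      then show "p \<in> UNIV \<times> S" by (simp add: mem_Times_iff)
    qed
  qed (use P K_borel in auto)
  then have nu_S: "measure \<nu> Y \<le> measure \<nu> S" using XY(2) comp by simp
  have "cap E \<le> measure \<mu> T + measure \<nu> (- D0)"
  proof (rule lim, rule coupling_le_snd)
    show "K n \<inter> UNIV \<times> D0 \<subseteq> T \<times> UNIV" for n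
    proof
      fix p assume "p \<in> K n \<inter> UNIV \<times> D0"
      then obtain m where "p \<in> K n \<inter> UNIV \<times> L' m" by (auto simp: D0_def)
      then have "fst p \<in> T" unfolding T_def by blast
      then show "p \<in> T \<times> UNIV" by (simp add: mem_Times_iff)
    qed
  qed (use P K_borel in auto)
  then have mu_T: "measure \<mu> X \<le> measure \<mu> T" using XY(2) comp by simp
  define A where "A = A0 \<union> S"
  define A' where "A' = D0 \<union> T"
  have A_rel: "\<exists>a\<in>A0. (a, x) \<in> E" if "x \<in> A" for x
    using that S_rel E_refl unfolding A_def by blast
  have A'_rel: "\<exists>b\<in>D0. (x, b) \<in> E" if "x \<in> A'" for x
    using that T_rel E_refl unfolding A'_def by blast
  \<comment> \<open>A related pair would join a point of \<open>A0\<close> to a point of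
    \<open>D0\<close> by a chain of three links, which the cover rules out.\<close>
  have sep: "(x, y) \<notin> E" if "x \<in> A" "y \<in> A'" for x y
    using A_rel[OF that(1)] A'_rel[OF that(2)] not_rel E_trans by meson
  have disj: "A \<inter> A' = {}" using sep E_refl by blast
  have AA' [simp]: "A \<in> sets borel" "A' \<in> sets borel"
    unfolding A_def A'_def by (rule sets.Un[OF A0 S], rule sets.Un[OF D0 T])
  \<comment> \<open>\<open>A0\<close> has mass \<open>1 - measure \<mu> X\<close>, and the disjoint
    set \<open>T\<close> supplies at least the rest. For \<open>\<nu>\<close> the same happens with
    \<open>D0\<close> and \<open>S\<close>.\<close>
  have "measure \<mu> A0 + measure \<mu> T = measure \<mu> (A0 \<union> T)"
    using disj by (intro \<mu>.finite_measure_Union[symmetric]) (auto simp: A_def A'_def sets.Un)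
  also have "\<dots> \<le> measure \<mu> (A \<union> A')" by (intro \<mu>.finite_measure_mono) (auto simp: A_def A'_def sets.Un)
  finally have "1 \<le> measure \<mu> (A \<union> A')" using meas_A0 mu_T by simp
  then have mu_B: "measure \<mu> (A \<union> A') = 1" using \<mu>.prob_le_1[of "A \<union> A'"] by linarith
  have "measure \<nu> D0 + measure \<nu> S = measure \<nu> (D0 \<union> S)"
    using disj by (intro \<nu>.finite_measure_Union[symmetric]) (auto simp: A_def A'_def sets.Un)
  also have "\<dots> \<le> measure \<nu> (A \<union> A')" by (intro \<nu>.finite_measure_mono) (auto simp: A_def A'_def sets.Un)
  finally have "1 \<le> measure \<nu> (A \<union> A')" using meas_D0 nu_S by simp
  then have nu_B: "measure \<nu> (A \<union> A') = 1" using \<nu>.prob_le_1[of "A \<union> A'"] by linarith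
  have inv: "x \<in> A \<longleftrightarrow> y \<in> A" if "(x, y) \<in> E" "x \<in> A \<union> A'" "y \<in> A \<union> A'" for x y
    using sep[of x y] sep[of y x] E_sym[OF that(1)] that by blast
  \<comment> \<open>\<open>A\<close> contains \<open>A0\<close> and misses \<open>D0\<close>, so its
    \<open>\<mu>\<close>-mass is at least \<open>1 - measure \<mu> X\<close> and its
    \<open>\<nu>\<close>-mass at most \<open>measure \<nu> Y\<close>; optimality of the cover gives
    the gap.\<close>
  have "measure \<mu> A0 \<le> measure \<mu> A" by (intro \<mu>.finite_measure_mono) (auto simp: A_def sets.Un)
  moreover have "measure \<nu> A + measure \<nu> D0 = measure \<nu> (A \<union> D0)"
    using disj by (intro \<nu>.finite_measure_Union[symmetric]) (auto simp: A'_def sets.Un)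
  ultimately have gap: "1 - cap E \<le> measure \<mu> A - measure \<nu> A"
    using meas_A0 meas_D0 XY(2) \<nu>.prob_le_1[of "A \<union> D0"] by linarith
  have "1 - measure (P n) E \<le> measure \<mu> A - measure \<nu> A + 1 / real (Suc n)" for n
  proof -
    interpret Pn: prob_space "P n" using P[of n] by (simp add: coupling_def)
    have "measure (P n) (K n) \<le> measure (P n) E"
      by (rule Pn.finite_measure_mono[OF K(2)]) (use P[of n] E(1) in \<open>simp add: coupling_def\<close>)
    then show ?thesis using PK[of n] gap by linarith
  qed
  then show ?thesis using P inv mu_B nu_B
    by (intro exI[of _ A] exI[of _ "A \<union> A'"] exI[of _ P] conjI) auto
qed

section \<open>Transfer to standard Borel spaces\<close>

text \<open>Distances to a dense sequence embed the space homeomorphically into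
  \<open>nat \<Rightarrow> real\<close>. The image is completely metrizable, hence a G-delta and
  Borel, so the inverse extends measurably by a constant outside the image.\<close>

lemma standard_borel_embedding:
  assumes M: "standard_borel_space M" and ne: "space M \<noteq> {}"
  obtains f :: "'a \<Rightarrow> nat \<Rightarrow> real" and g
  where "f \<in> M \<rightarrow>\<^sub>M borel" "g \<in> borel \<rightarrow>\<^sub>M M" "\<And>x. x \<in> space M \<Longrightarrow> g (f x) = x"
proof -
  obtain T where T: "topspace T = space M" "separable_space T" "completely_metrizable_space T"
    and sets_M: "sets M = sigma_sets (space M) {U. openin T U}"
    using M unfolding standard_borel_space_def by blast
  obtain S d where Sd: "Metric_space S d" and T_eq: "T = Metric_space.mtopology S d"
    using T(3) unfolding completely_metrizable_space_def by blast
  interpret Metric_space S d by fact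
  have S: "space M = S" using T(1) by (simp add: T_eq)
  obtain C where C: "countable C" "C \<subseteq> S" "mtopology closure_of C = S"
    using T(2) unfolding separable_space_def T_eq by auto
  have "C \<noteq> {}" using C(3) ne S by auto
  define c where "c = from_nat_into C"
  have rc: "range c = C" unfolding c_def by (rule range_from_nat_into[OF \<open>C \<noteq> {}\<close> C(1)])
  then have cS: "c n \<in> S" for n using C(2) by blast
  have dense: "\<exists>n. d x (c n) < r" if "x \<in> S" and r: "0 < r" for x r
  proof -
    have "x \<in> mtopology closure_of C" using that C(3) by simp
    then obtain y where "y \<in> C" "d x y < r" using r by (auto simp: metric_closure_of)
    then show ?thesis using rc by blast
  qed
  define f where "f x n = d x (c n)" for x n
  have cont: "continuous_map mtopology euclidean f"
    unfolding euclidean_product_topology[symmetric] continuous_map_componentwise_UNIV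
  proof
    fix k
    have "continuous_map mtopology Met_TC.mtopology (\<lambda>x. f x k)"
      unfolding Met_TC.continuous_map_to_metric
    proof (intro ballI allI impI)
      fix x and e :: real assume x: "x \<in> topspace mtopology" "0 < e"
      have "f y k \<in> ball (f x k) e" if "y \<in> mball x e" for y
        using that mdist_reverse_triangle[of x "c k" y] cS[of k] commute[of "c k" y]
        by (simp add: f_def dist_real_def)
      then show "\<exists>U. openin mtopology U \<and> x \<in> U \<and> (\<forall>y\<in>U. f y k \<in> Met_TC.mball (f x k) e)"
        using x by (intro exI[of _ "mball x e"]) auto
    qed
    then show "continuous_map mtopology euclidean (\<lambda>x. f x k)" by simp
  qed
  have pre: "\<exists>V. open V \<and> U = {y \<in> S. f y \<in> V}" if U: "openin mtopology U" for U
  proof -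
    \<comment> \<open>An open set is the union of the balls around points of the dense sequence that
      it contains, and such a ball is the preimage under \<open>f\<close> of an open
      half-space.\<close>
    define V where "V = \<Union>{{v. v n < r} | n r. {y \<in> S. d y (c n) < r} \<subseteq> U}"
    have "open {v :: nat \<Rightarrow> real. v n < r}" for n r
      by (intro open_Collect_less continuous_on_product_coordinates continuous_on_const)
    then have "open V" unfolding V_def by blast
    moreover have "x \<in> S \<and> f x \<in> V" if "x \<in> U" for x
    proof -
      obtain r where r: "0 < r" "mball x r \<subseteq> U" "x \<in> S" using U \<open>x \<in> U\<close> unfolding openin_mtopology by blast
      obtain n where n: "d x (c n) < r / 2" using dense[OF r(3), of "r/2"] r(1) by auto
      have "d x y < r" if "y \<in> S" "d y (c n) < r / 2" for y
        using triangle[OF r(3) cS that(1), of n] n that commute[of y "c n"] by linarith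
      then have "{y \<in> S. d y (c n) < r / 2} \<subseteq> U" using r(2,3) by auto
      then have "{v. v n < r / 2} \<subseteq> V" unfolding V_def by blast
      moreover have "f x \<in> {v. v n < r / 2}" using n by (simp add: f_def)
      ultimately show ?thesis using r(3) by blast
    qed
    moreover have "x \<in> U" if x: "x \<in> S" "f x \<in> V" for x
    proof -
      obtain n r where "{y \<in> S. d y (c n) < r} \<subseteq> U" "f x n < r" using x(2) unfolding V_def by blast
      then show ?thesis using x(1) by (auto simp: f_def)
    qed
    ultimately show ?thesis by blast
  qed
  have inj: "inj_on f S"
  proof (rule inj_onI, rule ccontr)
    fix x y assume xy: "x \<in> S" "y \<in> S" "f x = f y" "x \<noteq> y"
    then have "0 < d x y" by simp
    then obtain n where "d x (c n) < d x y / 2" using dense[OF xy(1), of "d x y / 2"] by auto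
    moreover have "d x (c n) = d y (c n)" using fun_cong[OF xy(3), of n] by (simp add: f_def)
    ultimately show False using triangle[OF xy(1) cS xy(2), of n] commute[of y "c n"] by linarith
  qed
  have "homeomorphic_map mtopology (top_of_set (f ` S)) f"
  proof (rule bijective_open_imp_homeomorphic_map)
    show "continuous_map mtopology (top_of_set (f ` S)) f"
      using cont by (auto simp: continuous_map_in_subtopology)
    show "open_map mtopology (top_of_set (f ` S)) f"
      unfolding open_map_def
    proof (intro allI impI)
      fix U assume "openin mtopology U"
      then obtain V where "open V" "U = {y \<in> S. f y \<in> V}" using pre by blast
      then have "f ` U = V \<inter> f ` S" by auto
      then show "openin (top_of_set (f ` S)) (f ` U)"
        using \<open>open V\<close> by (auto simp: openin_subtopology)
    qed
  qed (use inj in auto)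
  then have "mtopology homeomorphic_space top_of_set (f ` S)" unfolding homeomorphic_space by blast
  then have "completely_metrizable_space (top_of_set (f ` S))"
    using T(3) homeomorphic_completely_metrizable_space unfolding T_eq by blast
  then have "gdelta_in euclidean (f ` S)"
    by (intro completely_metrizable_space_imp_gdelta_in metrizable_space_euclidean) auto
  then obtain G :: "nat \<Rightarrow> (nat \<Rightarrow> real) set" where G: "\<And>n. open (G n)" "\<Inter>(range G) = f ` S"
    unfolding gdelta_in_descending by auto
  have "\<Inter>(range G) \<in> sets borel" using G(1) by (intro sets.countable_INT'') auto
  then have fS: "f ` S \<in> sets borel" by (simp add: G(2))
  obtain x0 where x0: "x0 \<in> S" using ne S by blast
  define g where "g v = (if v \<in> f ` S then inv_into S f v else x0)" for v
  have gf: "g (f x) = x" if "x \<in> S" for x using that inj by (simp add: g_def)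
  have "f \<in> M \<rightarrow>\<^sub>M borel"
  proof (rule borel_measurableI)
    fix V :: "(nat \<Rightarrow> real) set" assume "open V"
    then have "openin mtopology {x \<in> S. f x \<in> V}"
      using cont by (auto simp: continuous_map_def)
    moreover have "f -` V \<inter> space M = {x \<in> S. f x \<in> V}" using S by auto
    ultimately show "f -` V \<inter> space M \<in> sets M" unfolding sets_M T_eq by auto
  qed
  moreover have "g \<in> borel \<rightarrow>\<^sub>M M"
  proof (rule measurable_sigma_sets[OF sets_M])
    show "{U. openin T U} \<subseteq> Pow (space M)" using openin_subset T(1) by blast
    show "g \<in> space borel \<rightarrow> space M" using x0 by (auto simp: g_def S inv_into_into)
    fix U assume "U \<in> {U. openin T U}"
    then obtain V where V: "open V" "U = {y \<in> S. f y \<in> V}" using pre unfolding T_eq by blast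
    have "g -` U \<inter> space borel = (V \<inter> f ` S) \<union> (if x0 \<in> U then - f ` S else {})"
      using V(2) inj x0 by (auto simp: g_def)
    also have "\<dots> \<in> sets borel" using V(1) fS by auto
    finally show "g -` U \<inter> space borel \<in> sets borel" .
  qed
  ultimately show ?thesis using gf by (intro that[of f g]) (auto simp: S)
qed

text \<open>If both coordinates lie in \<open>B\<close> and are related, then they lie in
  \<open>A\<close> together or not at all. So the two marginal masses of \<open>A\<close> differ at
  most by the mass of the exceptional pairs.\<close>

lemma coupling_invariant_bound:
  assumes \<mu>: "\<mu> \<in> space (prob_algebra M)" and \<nu>: "\<nu> \<in> space (prob_algebra M)"
    and P: "P \<in> couplings M \<mu> \<nu>" and E: "E \<in> sets (M \<Otimes>\<^sub>M M)"
    and B: "B \<in> sets M" "measure \<mu> B = 1" "measure \<nu> B = 1"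
    and A: "A \<in> invariant_sets_on M E B"
  shows "\<bar>measure \<mu> A - measure \<nu> A\<bar> \<le> 1 - measure P E"
proof -
  interpret \<mu>: prob_space \<mu> using \<mu> by (simp add: space_prob_algebra)
  interpret \<nu>: prob_space \<nu> using \<nu> by (simp add: space_prob_algebra)
  interpret P: prob_space P using P by (simp add: couplings_def space_prob_algebra)
  have sets_P: "sets P = sets (M \<Otimes>\<^sub>M M)" using P by (simp add: couplings_def space_prob_algebra)
  have sp: "space \<mu> = space M" "space \<nu> = space M"
    using \<mu> \<nu> by (auto simp: space_prob_algebra dest: sets_eq_imp_space_eq)
  have sets_\<mu>\<nu>: "sets \<mu> = sets M" "sets \<nu> = sets M" using \<mu> \<nu> by (auto simp: space_prob_algebra)
  have sp_P: "space P = space M \<times> space M"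
    using sets_eq_imp_space_eq[OF sets_P] by (simp add: space_pair_measure)
  let ?S = "space M"
  have A_sets: "A \<in> sets M" and inv: "\<And>x y. (x, y) \<in> E \<Longrightarrow> x \<in> B \<Longrightarrow> y \<in> B \<Longrightarrow> x \<in> A \<longleftrightarrow> y \<in> A"
    using A by (force simp: invariant_sets_on_def indicator_def split: if_splits)+
  have m1: "measure P (C \<times> ?S) = measure \<mu> C" and m2: "measure P (?S \<times> C) = measure \<nu> C"
    if "C \<in> sets M" for C using P that by (auto simp: couplings_def)
  have sets_times: "C \<times> ?S \<in> sets P" "?S \<times> C \<in> sets P" if "C \<in> sets M" for C
    unfolding sets_P using that by auto
  have null: "measure \<mu> (?S - B) = 0" "measure \<nu> (?S - B) = 0"
    using \<mu>.prob_compl[of B] \<nu>.prob_compl[of B] B sp sets_\<mu>\<nu> by auto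
  \<comment> \<open>The parts of \<open>N\<close> outside \<open>B\<close> are null because
    \<open>B\<close> has full mass in both marginals; only the failure of \<open>E\<close>
    counts.\<close>
  define N where "N = (?S - B) \<times> ?S \<union> ?S \<times> (?S - B) \<union> (space P - E)"
  have N_sets: "N \<in> sets P" unfolding N_def
    using E B(1) by (intro sets.Un sets_times sets.compl_sets) (auto simp: sets_P)
  have "measure P N \<le> measure P ((?S - B) \<times> ?S) + measure P (?S \<times> (?S - B)) + measure P (space P - E)"
    unfolding N_def using E B(1)
    by (intro order_trans[OF measure_Un_le] add_mono order_refl measure_Un_le sets.Un sets_times sets.compl_sets)
      (auto simp: sets_P)
  also have "\<dots> = 1 - measure P E"
    using B(1) E by (simp add: m1 m2 null P.prob_compl sets_P)
  finally have N: "measure P N \<le> 1 - measure P E" .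
  have A_sub: "A \<subseteq> ?S" using A_sets sets.sets_into_space by blast
  have "A \<times> ?S \<subseteq> ?S \<times> A \<union> N" "?S \<times> A \<subseteq> A \<times> ?S \<union> N"
    using inv A_sub by (auto simp: N_def sp_P)
  then have "measure P (A \<times> ?S) \<le> measure P (?S \<times> A) + measure P N"
    "measure P (?S \<times> A) \<le> measure P (A \<times> ?S) + measure P N"
    using sets_times[OF A_sets] N_sets
    by (meson P.finite_measure_mono measure_Un_le order_trans sets.Un)+
  then show ?thesis using N m1[OF A_sets] m2[OF A_sets] by linarith
qed

theorem theorem3:
  fixes M :: "'a measure" and E :: "('a \<times> 'a) set"
  assumes "standard_borel_space M"
    and "measurable_equivalence M E"
  shows "\<forall>\<mu>\<in>space (prob_algebra M). \<forall>\<nu>\<in>space (prob_algebra M).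
           \<exists>B\<in>sets M. measure \<mu> B = 1 \<and> measure \<nu> B = 1 \<and>
             (INF P\<in>couplings M \<mu> \<nu>. 1 - measure P E) =
               variation_on (invariant_sets_on M E B) \<mu> \<nu>"
proof (intro ballI)
  fix \<mu> \<nu> assume \<mu>: "\<mu> \<in> space (prob_algebra M)" and \<nu>: "\<nu> \<in> space (prob_algebra M)"
  interpret \<mu>: prob_space \<mu> using \<mu> by (simp add: space_prob_algebra)
  interpret \<nu>: prob_space \<nu> using \<nu> by (simp add: space_prob_algebra)
  have sets_\<mu> [measurable_cong]: "sets \<mu> = sets M" and sets_\<nu> [measurable_cong]: "sets \<nu> = sets M"
    using \<mu> \<nu> by (auto simp: space_prob_algebra)
  have sp: "space \<mu> = space M" "space \<nu> = space M"
    using sets_eq_imp_space_eq[OF sets_\<mu>] sets_eq_imp_space_eq[OF sets_\<nu>] by auto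
  have E [measurable]: "E \<in> sets (M \<Otimes>\<^sub>M M)" and equiv: "equiv (space M) E"
    using assms(2) by (auto simp: measurable_equivalence_def)
  have "space M \<noteq> {}" using \<mu>.not_empty sp by simp
  then obtain f :: "'a \<Rightarrow> nat \<Rightarrow> real" and g where f [measurable]: "f \<in> M \<rightarrow>\<^sub>M borel"
    and g [measurable]: "g \<in> borel \<rightarrow>\<^sub>M M" and gf: "\<And>x. x \<in> space M \<Longrightarrow> g (f x) = x"
    using standard_borel_embedding[OF assms(1)] by metis
  have g_space: "g v \<in> space M" for v using measurable_space[OF g, of v] by simp
  define \<mu>' where "\<mu>' = distr \<mu> borel f"
  define \<nu>' where "\<nu>' = distr \<nu> borel f"
  have "prob_space \<mu>'" unfolding \<mu>'_def by (rule \<mu>.prob_space_distr) measurable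
  moreover have "prob_space \<nu>'" unfolding \<nu>'_def by (rule \<nu>.prob_space_distr) measurable
  ultimately interpret m: marginals \<mu>' \<nu>'
    by (intro marginals.intro marginals_axioms.intro) (simp_all add: \<mu>'_def \<nu>'_def)
  have meas': "measure \<mu>' C = measure \<mu> (f -` C \<inter> space M)" "measure \<nu>' C = measure \<nu> (f -` C \<inter> space M)"
    if "C \<in> sets borel" for C
    using that by (simp_all add: \<mu>'_def \<nu>'_def measure_distr sp)
  \<comment> \<open>\<open>E\<close> is pulled back along \<open>g\<close> and not pushed forward
    along \<open>f\<close>: this gives a Borel equivalence relation on the whole sequence space,
    including the points outside the image of \<open>f\<close>.\<close>
  define E' where "E' = {p. (g (fst p), g (snd p)) \<in> E}"
  have gg: "(\<lambda>p. (g (fst p), g (snd p))) \<in> borel \<rightarrow>\<^sub>M M \<Otimes>\<^sub>M M"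
    unfolding borel_prod[symmetric] by measurable
  have E': "E' \<in> sets borel" using measurable_sets[OF gg E] by (simp add: E'_def vimage_def)
  have "equiv UNIV E'"
  proof (rule equivI)
    show "refl E'" using equiv g_space by (auto simp: E'_def equiv_def refl_on_def)
    show "sym E'" using equiv by (auto simp: E'_def equiv_def sym_def)
    have "trans E" using equiv by (simp add: equiv_def)
    then show "trans E'" by (intro transI) (auto simp: E'_def dest: transD)
  qed simp
  obtain A B P where A: "A \<in> sets borel" and B: "B \<in> sets borel" "measure \<mu>' B = 1" "measure \<nu>' B = 1"
    and inv: "\<forall>(u, v)\<in>E' \<inter> B \<times> B. u \<in> A \<longleftrightarrow> v \<in> A"
    and "\<forall>n::nat. m.coupling (P n) \<and> 1 - measure (P n) E' \<le> measure \<mu>' A - measure \<nu>' A + 1 / real (Suc n)"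
    using invariant_separation_polish[OF m.marginals_axioms E' \<open>equiv UNIV E'\<close>] by (elim exE conjE)
  then have P: "\<And>n. m.coupling (P n)"
    "\<And>n. 1 - measure (P n) E' \<le> measure \<mu>' A - measure \<nu>' A + 1 / real (Suc n)" by auto
  define AM where "AM = f -` A \<inter> space M"
  define BM where "BM = f -` B \<inter> space M"
  have BM: "BM \<in> sets M" "measure \<mu> BM = 1" "measure \<nu> BM = 1"
    using measurable_sets[OF f B(1)] meas'[OF B(1)] B(2,3) by (simp_all add: BM_def)
  have AM: "AM \<in> invariant_sets_on M E BM"
  proof -
    have "x \<in> AM \<longleftrightarrow> y \<in> AM" if "(x, y) \<in> E" "x \<in> BM" "y \<in> BM" for x y
    proof -
      have "(f x, f y) \<in> E' \<inter> B \<times> B" using that gf by (auto simp: E'_def BM_def)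
      with inv have "f x \<in> A \<longleftrightarrow> f y \<in> A" by blast
      then show ?thesis using that by (auto simp: AM_def BM_def)
    qed
    then show ?thesis
      using measurable_sets[OF f A] by (auto simp: invariant_sets_on_def AM_def[symmetric] indicator_def)
  qed
  \<comment> \<open>As \<open>g\<close> inverts \<open>f\<close> on \<open>space M\<close>, pushing
    forward by \<open>g\<close> in both coordinates turns the marginals \<open>\<mu>'\<close> and
    \<open>\<nu>'\<close> back into \<open>\<mu>\<close> and \<open>\<nu>\<close>.\<close>
  define Q where "Q n = distr (P n) (M \<Otimes>\<^sub>M M) (\<lambda>p. (g (fst p), g (snd p)))" for n
  have Q: "Q n \<in> couplings M \<mu> \<nu> \<and> measure (Q n) E = measure (P n) E'" for n
  proof -
    interpret Pn: prob_space "P n" using P(1)[of n] by (simp add: m.coupling_def)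
    have sets_Pn: "sets (P n) = sets borel" using P(1)[of n] by (simp add: m.coupling_def)
    have sp_Pn: "space (P n) = UNIV" using sets_eq_imp_space_eq[OF sets_Pn] by simp
    have gg' [measurable]: "(\<lambda>p. (g (fst p), g (snd p))) \<in> P n \<rightarrow>\<^sub>M M \<Otimes>\<^sub>M M"
      using gg by (subst measurable_cong_sets[OF sets_Pn refl])
    have Qm: "measure (Q n) C = measure (P n) {p. (g (fst p), g (snd p)) \<in> C}" if "C \<in> sets (M \<Otimes>\<^sub>M M)" for C
      using measure_distr[OF gg' that] by (simp add: Q_def vimage_def sp_Pn)
    have "prob_space (Q n)" unfolding Q_def by (rule Pn.prob_space_distr) measurable
    moreover have "measure (Q n) (C \<times> space M) = measure \<mu> C \<and> measure (Q n) (space M \<times> C) = measure \<nu> C"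
      if C: "C \<in> sets M" for C
    proof -
      have gC: "g -` C \<in> sets borel" using measurable_sets[OF g C] by simp
      have pre: "f -` (g -` C) \<inter> space M = C" using gf sets.sets_into_space[OF C] by auto
      have "{p. (g (fst p), g (snd p)) \<in> C \<times> space M} = (g -` C) \<times> UNIV"
        "{p. (g (fst p), g (snd p)) \<in> space M \<times> C} = UNIV \<times> (g -` C)" using g_space by auto
      then have "measure (Q n) (C \<times> space M) = measure (P n) ((g -` C) \<times> UNIV)"
        "measure (Q n) (space M \<times> C) = measure (P n) (UNIV \<times> (g -` C))" using C by (simp_all add: Qm)
      then show ?thesis using P(1)[of n] gC meas'[OF gC] pre by (simp add: m.coupling_def)
    qed
    moreover have "sets (Q n) = sets (M \<Otimes>\<^sub>M M)" by (simp add: Q_def)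
    ultimately show ?thesis
      using Qm[OF E] by (simp add: couplings_def space_prob_algebra E'_def)
  qed
  have upper: "\<bar>measure \<mu> C - measure \<nu> C\<bar> \<le> 1 - measure R E"
    if "R \<in> couplings M \<mu> \<nu>" "C \<in> invariant_sets_on M E BM" for R C
    by (rule coupling_invariant_bound[OF \<mu> \<nu> that(1) E BM that(2)])
  \<comment> \<open>\<open>Q\<close> and \<open>AM\<close> also ensure that neither the infimum nor
    the supremum ranges over an empty set.\<close>
  have "variation_on (invariant_sets_on M E BM) \<mu> \<nu> \<le> (INF R\<in>couplings M \<mu> \<nu>. 1 - measure R E)"
    unfolding variation_on_def
    using Q AM by (intro cINF_greatest cSUP_least upper) auto
  moreover have "(INF R\<in>couplings M \<mu> \<nu>. 1 - measure R E) \<le> variation_on (invariant_sets_on M E BM) \<mu> \<nu>"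
  proof (rule field_le_epsilon)
    fix e :: real assume "0 < e"
    then obtain n where n: "1 / real (Suc n) < e" by (metis nat_approx_posE)
    have "(INF R\<in>couplings M \<mu> \<nu>. 1 - measure R E) \<le> 1 - measure (Q n) E"
    proof (rule cINF_lower)
      have "0 \<le> 1 - measure R E" if "R \<in> couplings M \<mu> \<nu>" for R
        using upper[OF that AM] by linarith
      then show "bdd_below ((\<lambda>R. 1 - measure R E) ` couplings M \<mu> \<nu>)"
        by (auto intro!: bdd_belowI2[of _ 0])
    qed (use Q in blast)
    also have "\<dots> \<le> measure \<mu> AM - measure \<nu> AM + 1 / real (Suc n)"
      using P(2)[of n] Q[of n] meas'[OF A] by (simp add: AM_def)
    also have "measure \<mu> AM - measure \<nu> AM \<le> variation_on (invariant_sets_on M E BM) \<mu> \<nu>"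
      unfolding variation_on_def
    proof (rule cSUP_upper2[OF _ AM])
      show "bdd_above ((\<lambda>A. \<bar>measure \<mu> A - measure \<nu> A\<bar>) ` invariant_sets_on M E BM)"
        using upper[of "Q 0"] Q[of 0] by (intro bdd_aboveI2[of _ _ "1 - measure (Q 0) E"]) blast
    qed simp
    finally show "(INF R\<in>couplings M \<mu> \<nu>. 1 - measure R E) \<le> variation_on (invariant_sets_on M E BM) \<mu> \<nu> + e"
      using n by linarith
  qed
  ultimately show "\<exists>B\<in>sets M. measure \<mu> B = 1 \<and> measure \<nu> B = 1 \<and>
      (INF P\<in>couplings M \<mu> \<nu>. 1 - measure P E) = variation_on (invariant_sets_on M E B) \<mu> \<nu>"
    using BM by (intro bexI[of _ BM]) auto
qed

end
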